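(* Let $G$ be a connected graph and let $X=\{x_1,\ldots,x_t\}\subseteq V(G)$ with $t\in\{1,2,3\}$ (where $x_1,\ldots,x_t$ are distinct) be such that $d_G(v,X)\le 2$ for each $v\in V(G)\setminus X$, and such that one of the following holds: (i) $t=1$ and $|N(x_1)|\ge 2$; or (ii) $t=2$, $e(G)\ge 2|V(G)|-5$, and there exist distinct vertices $y_1,\ldots,y_7\in V(G)\setminus X$ such that $x_1$ is complete to either $\{y_1,y_2,y_3,x_2\}$ or $\{y_1,y_2,y_3,y_4\}$, and $x_2$ is complete to $\{y_4,y_5,y_6,y_7\}$; or (iii) $t=3$, $e(G)\ge 2|V(G)|-4$, and there exist distinct vertices $y_1,\ldots,y_{11}\in V(G)\setminus X$ such that $x_1$ is complete to $\{y_1,y_2,y_3,y_4\}$, $x_2$ is complete to $\{y_4,y_5,y_6,y_7,y_8\}$, and $x_3$ is complete to either $\{y_4,y_9,y_{10},y_{11}\}$ or $\{y_8,y_9,y_{10},y_{11}\}$. Then $G$ admits an antimagic orientation.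
   Context: All graphs are finite and simple. $e(G)$ denotes the number of edges of $G$, and $N(x)$ the set of neighbors of $x$ in $G$. A vertex $a$ is complete to a set $B\subseteq V(G)\setminus\{a\}$ if $a$ is adjacent to every vertex of $B$. For a connected graph $G$, $d_G(x,y)$ is the length of a shortest path between $x$ and $y$, and for $X\subseteq V(G)$ and $v\in V(G)\setminus X$, $d_G(v,X):=\min_{x\in X} d_G(v,x)$. For a digraph $D$ with $m$ arcs, arc set $A(D)$, and a bijection $\tau:A(D)\to\{1,2,\ldots,m\}$, the vertex-sum $s_{(D,\tau)}(u)$ of a vertex $u$ is the sum of the labels of all arcs entering $u$ minus the sum of the labels of all arcs leaving $u$ (and $s_{(D,\tau)}(u):=0$ if $u$ is isolated). The bijection $\tau$ is an antimagic labeling of $D$ if $s_{(D,\tau)}(u)\ne s_{(D,\tau)}(v)$ for all distinct vertices $u,v$ of $D$. An antimagic orientation of a graph $G$ is a pair $(D,\tau)$ where $D$ is an orientation of $G$ (each edge of $G$ is replaced by exactly one of its two possible arcs) and $\tau$ is an antimagic labeling of $D$. *)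

theory Defs
  imports Main "Graph_Theory.Digraph_Component"
begin

text \<open>
  A finite simple graph is a \<^locale>\<open>pair_graph\<close>, i.e. a finite loop-free symmetric digraph whose
  arcs are pairs of vertices; an undirected edge is represented by its two opposite arcs.
\<close>

definition edges :: "'a pair_pre_digraph \<Rightarrow> 'a set set" where
  "edges G = {{u, v} | u v. (u, v) \<in> parcs G}"

definition neighbors :: "'a pair_pre_digraph \<Rightarrow> 'a \<Rightarrow> 'a set" where
  "neighbors G u = {v. (u, v) \<in> parcs G}"

definition complete_to :: "'a pair_pre_digraph \<Rightarrow> 'a \<Rightarrow> 'a set \<Rightarrow> bool" where
  "complete_to G a B \<longleftrightarrow> B \<subseteq> pverts G - {a} \<and> (\<forall>b\<in>B. (a, b) \<in> parcs G)"

text \<open>The distance is only meaningful for vertices joined by a path, e.g. in a connected graph.\<close>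

definition graph_dist :: "'a pair_pre_digraph \<Rightarrow> 'a \<Rightarrow> 'a \<Rightarrow> nat" where
  "graph_dist G u v = (LEAST n. \<exists>p. pre_digraph.apath (with_proj G) u p v \<and> length p = n)"

text \<open>Only meaningful for finite nonempty \<^term>\<open>X\<close>.\<close>

definition graph_dist_set :: "'a pair_pre_digraph \<Rightarrow> 'a \<Rightarrow> 'a set \<Rightarrow> nat" where
  "graph_dist_set G v X = Min (graph_dist G v ` X)"

definition is_orientation :: "'a pair_pre_digraph \<Rightarrow> 'a pair_pre_digraph \<Rightarrow> bool" where
  "is_orientation G D \<longleftrightarrow>
     pverts D = pverts G \<and> parcs D \<subseteq> parcs G \<and>
     (\<forall>(u, v) \<in> parcs G. (u, v) \<in> parcs D \<longleftrightarrow> (v, u) \<notin> parcs D)"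

text \<open>An isolated vertex gets two empty sums, hence vertex-sum 0.\<close>

definition vertex_sum :: "'a pair_pre_digraph \<Rightarrow> ('a \<times> 'a \<Rightarrow> nat) \<Rightarrow> 'a \<Rightarrow> int" where
  "vertex_sum D \<tau> u =
     (\<Sum>e\<in>in_arcs (with_proj D) u. int (\<tau> e)) - (\<Sum>e\<in>out_arcs (with_proj D) u. int (\<tau> e))"

definition antimagic_labeling :: "'a pair_pre_digraph \<Rightarrow> ('a \<times> 'a \<Rightarrow> nat) \<Rightarrow> bool" where
  "antimagic_labeling D \<tau> \<longleftrightarrow>
     bij_betw \<tau> (parcs D) {1..card (parcs D)} \<and>
     (\<forall>u\<in>pverts D. \<forall>v\<in>pverts D. u \<noteq> v \<longrightarrow> vertex_sum D \<tau> u \<noteq> vertex_sum D \<tau> v)"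

definition antimagic_orientation ::
  "'a pair_pre_digraph \<Rightarrow> 'a pair_pre_digraph \<times> ('a \<times> 'a \<Rightarrow> nat) \<Rightarrow> bool" where
  "antimagic_orientation G = (\<lambda>(D, \<tau>). is_orientation G D \<and> antimagic_labeling D \<tau>)"

end

theory Submission
  imports Defs "Graph_Theory.Vertex_Walk"
begin

text \<open>
  Let \<open>A\<close> be the set of vertices outside \<open>X\<close> with a neighbour in \<open>X\<close>, and \<open>B\<close> the set of the
  remaining vertices. Choose for each \<open>a \<in> A\<close> a star arc \<open>(a, \<sigma> a)\<close> with \<open>\<sigma> a \<in> X\<close>, and for each
  \<open>b \<in> B\<close> a twig \<open>(\<pi> b, b)\<close> with \<open>\<pi> b \<in> A\<close>. The twigs and star arcs get the largest labels. The star
  arcs and all other arcs between \<open>A\<close> and \<open>X\<close> point to \<open>X\<close>, and the twigs point to \<open>B\<close>. So star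
  arcs and twigs push the sums on \<open>A\<close> down and the sums on \<open>B\<close> up.

  Two ideas make all sums on \<open>A \<union> B\<close> distinct. First, the remaining edges inside \<open>A \<union> B\<close> are
  labelled along trails with small labels so that, if \<open>s\<close> is the largest of these, they contribute
  at most \<open>s\<close> at a vertex of \<open>A\<close> and at least \<open>-s\<close> at a vertex of \<open>B\<close> (\<open>balanced_orientation\<close>); as
  the labels of star arcs and twigs exceed \<open>s\<close>, all sums on \<open>A\<close> are negative and all sums on \<open>B\<close> are positive.
  Second, if each vertex of a set owns a private arc and everything else at the vertex is fixed,
  then giving larger labels to vertices with larger partial sums makes the sums distinct
  (\<open>sorted_assignment\<close>). This is done for \<open>B\<close> with the twigs and then for \<open>A\<close> with the star arcs
  (\<open>layered_labelling\<close>).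

  It remains to separate the centres. With one centre \<open>x\<close>, the sum at \<open>x\<close> is the sum of all star
  labels, wherever the individual labels go. Reserving the top \<open>card A - 1\<close> labels for star arcs,
  \<open>x\<close> takes part in the sorting of \<open>B\<close> and receives the smallest star label as its private one
  (\<open>single_centre\<close>).

  With two or three centres, each centre has three star arcs of its own. The bound on the number of
  edges makes all star labels so large that three of them outweigh every sum on \<open>A \<union> B\<close>. This
  needs the sums on \<open>B\<close> to be bounded above, too: in the trail labelling, two consecutive arcs of a
  trail meeting in \<open>B\<close> carry consecutive labels, so that they contribute exactly 1. The centres
  are then separated from each other by moves that affect no sum outside \<open>X\<close>: permuting the labels
  of the arcs from one vertex of \<open>A\<close> to several centres, or reversing an edge between two
  centres (\<open>centred_common_neighbour\<close>, \<open>centred_chain\<close>, \<open>centred_edge\<close>).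
\<close>

section \<open>Vertex sums of consecutively labelled arcs\<close>

definition signed_inc :: "'a \<Rightarrow> 'a \<times> 'a \<Rightarrow> int" where
  "signed_inc v e = of_bool (snd e = v) - of_bool (fst e = v)"

text \<open>The vertex sum at \<open>v\<close> when the arcs of the list are labelled \<open>c + 1, c + 2, \<dots>\<close> in order.\<close>
fun list_sum :: "nat \<Rightarrow> ('a \<times> 'a) list \<Rightarrow> 'a \<Rightarrow> int" where
  "list_sum c [] v = 0"
| "list_sum c (e # es) v = int (Suc c) * signed_inc v e + list_sum (Suc c) es v"

lemma list_sum_append:
  "list_sum c (es @ fs) v = list_sum c es v + list_sum (c + length es) fs v"
  by (induction es arbitrary: c) auto

definition out_count :: "'a \<Rightarrow> ('a \<times> 'a) list \<Rightarrow> nat" where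
  "out_count v es = length (filter (\<lambda>e. fst e = v) es)"

lemma out_count_append: "out_count v (es @ fs) = out_count v es + out_count v fs"
  by (simp add: out_count_def)

lemma out_count_mset: "mset es = mset fs \<Longrightarrow> out_count v es = out_count v fs"
  unfolding out_count_def by (metis mset_filter size_mset)

lemma list_sum_zero: "(\<And>e. e \<in> set es \<Longrightarrow> fst e \<noteq> v \<and> snd e \<noteq> v) \<Longrightarrow> list_sum c es v = 0"
  by (induction es arbitrary: c) (auto simp: signed_inc_def)

lemma list_sum_nonpos: "(\<And>e. e \<in> set es \<Longrightarrow> snd e \<noteq> v) \<Longrightarrow> list_sum c es v \<le> 0"
proof (induction es arbitrary: c)
  case (Cons e es)
  have "list_sum (Suc c) es v \<le> 0" by (rule Cons.IH) (use Cons.prems in auto)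
  moreover have "signed_inc v e \<le> 0" using Cons.prems[of e] by (simp add: signed_inc_def)
  then have "int (Suc c) * signed_inc v e \<le> 0" by (rule mult_nonneg_nonpos[rotated]) simp
  ultimately show ?case by simp
qed simp

section \<open>Decomposition into trails with disjoint ends\<close>

definition ends :: "'a list \<Rightarrow> 'a set" where
  "ends p = {hd p, last p}"

definition arc_edge :: "'a \<times> 'a \<Rightarrow> 'a set" where
  "arc_edge e = {fst e, snd e}"

definition trail_edges :: "'a list \<Rightarrow> 'a set multiset" where
  "trail_edges p = mset (map arc_edge (vwalk_arcs p))"

lemma trail_edges_join:
  "p \<noteq> [] \<Longrightarrow> q \<noteq> [] \<Longrightarrow>
   trail_edges (p @ q) = add_mset {last p, hd q} (trail_edges p + trail_edges q)"
  by (simp add: trail_edges_def vwalk_arcs_append arc_edge_def)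

lemma trail_edges_rev: "trail_edges (rev p) = trail_edges p"
proof (induction p)
  case (Cons u p)
  show ?case
  proof (cases "p = []")
    case False
    have "trail_edges ([u] @ p) = add_mset {u, hd p} (trail_edges p)"
      using False by (subst trail_edges_join) (auto simp: trail_edges_def)
    moreover have "trail_edges (rev p @ [u]) = add_mset {hd p, u} (trail_edges (rev p))"
      using False by (subst trail_edges_join) (auto simp: trail_edges_def last_rev)
    ultimately show ?thesis using Cons by (simp add: insert_commute)
  qed auto
qed auto

text \<open>
  A multiset of edges split into trails such that no vertex is an end of two trails. Trails of one
  vertex, which have no edges, are admitted; they let the trail to be extended at a given vertex
  be found in all cases alike.
\<close>
definition trail_system :: "'a list set \<Rightarrow> 'a set multiset \<Rightarrow> bool" where
  "trail_system ts M \<longleftrightarrow> finite ts \<and> [] \<notin> ts \<and>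
     (\<forall>p\<in>ts. \<forall>q\<in>ts. p \<noteq> q \<longrightarrow> ends p \<inter> ends q = {}) \<and> (\<Sum>p\<in>ts. trail_edges p) = M"

lemma trail_system_touch:
  assumes "trail_system ts M"
  obtains ts' where "trail_system ts' M" "ts \<subseteq> ts'" "\<exists>p\<in>ts'. u \<in> ends p"
proof (cases "\<exists>p\<in>ts. u \<in> ends p")
  case False
  have "trail_system (insert [u] ts) M"
    using assms False unfolding trail_system_def
    by (auto simp: sum.insert_if trail_edges_def ends_def)
  then show ?thesis using that[of "insert [u] ts"] by (auto simp: ends_def)
qed (use assms that in blast)

text \<open>
  The only way in which the induction changes a system: the trails in \<open>R\<close> are glued to one trail,
  with the help of new edges \<open>N\<close>, whose ends are ends of the glued trails.
\<close>
lemma trail_system_replace: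
  assumes ts: "trail_system ts M" and R: "R \<subseteq> ts" and p: "p \<noteq> []"
    and e: "ends p \<subseteq> (\<Union>q\<in>R. ends q)" and M: "trail_edges p = N + (\<Sum>q\<in>R. trail_edges q)"
  shows "trail_system (insert p (ts - R)) (N + M)"
proof -
  have fin: "finite ts" using ts by (simp add: trail_system_def)
  have disj: "ends p \<inter> ends q = {}" if "q \<in> ts - R" for q
  proof -
    have "ends r \<inter> ends q = {}" if "r \<in> R" for r
      using that \<open>q \<in> ts - R\<close> ts R unfolding trail_system_def by (metis DiffE subsetD)
    then show ?thesis using e by blast
  qed
  then have pn: "p \<notin> ts - R" by (auto simp: ends_def)
  have "M = (\<Sum>q\<in>ts - R. trail_edges q) + (\<Sum>q\<in>R. trail_edges q)"
    using ts sum.subset_diff[OF R fin, of trail_edges] by (simp add: trail_system_def)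
  then have "(\<Sum>q\<in>insert p (ts - R). trail_edges q) = N + M"
    using pn fin M by (simp add: sum.insert add_ac)
  then show ?thesis using ts disj p fin unfolding trail_system_def by blast
qed

text \<open>
  The new edge joins the trail ending at \<open>u\<close> to the trail ending at \<open>v\<close>, so that \<open>u\<close> and \<open>v\<close> are
  ends no longer. If both are the same trail, the edge closes it, and only one of \<open>u\<close> and \<open>v\<close>
  remains an end.
\<close>
lemma trail_system_add_edge:
  assumes "trail_system ts M" "u \<noteq> v"
  obtains ts' where "trail_system ts' (add_mset {u, v} M)"
proof -
  obtain ts1 where 1: "trail_system ts1 M" "\<exists>p\<in>ts1. u \<in> ends p"
    using trail_system_touch[OF assms(1), of u] by metis
  obtain ts2 where ts2: "trail_system ts2 M" "ts1 \<subseteq> ts2" "\<exists>p\<in>ts2. v \<in> ends p"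
    using trail_system_touch[OF 1(1), of v] by metis
  obtain p q where p: "p \<in> ts2" "u \<in> ends p" and q: "q \<in> ts2" "v \<in> ends q"
    using 1 ts2 by blast
  have ne: "p \<noteq> []" "q \<noteq> []" using p q ts2 by (auto simp: trail_system_def)
  show ?thesis
  proof (cases "p = q")
    case True
    have c: "{last p, hd p} = {u, v}" using p q True assms(2) by (auto simp: ends_def)
    have "trail_system (insert (p @ [hd p]) (ts2 - {p})) ({#{u, v}#} + M)"
      using ts2(1) by (rule trail_system_replace)
        (use p ne c in \<open>auto simp: ends_def trail_edges_join trail_edges_def[of "[_]"]\<close>)
    then show ?thesis using that by simp
  next
    case False
    define p' where "p' = (if last p = u then p else rev p)"
    define q' where "q' = (if hd q = v then q else rev q)"
    have p': "p' \<noteq> []" "last p' = u" "trail_edges p' = trail_edges p" "hd p' \<in> ends p"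
      using p ne by (auto simp: p'_def ends_def last_rev hd_rev trail_edges_rev)
    have q': "q' \<noteq> []" "hd q' = v" "trail_edges q' = trail_edges q" "last q' \<in> ends q"
      using q ne by (auto simp: q'_def ends_def last_rev hd_rev trail_edges_rev)
    have "trail_system (insert (p' @ q') (ts2 - {p, q})) ({#{u, v}#} + M)"
      using ts2(1) by (rule trail_system_replace)
        (use p q p' q' False in \<open>auto simp: ends_def[of "p' @ q'"] trail_edges_join\<close>)
    then show ?thesis using that by simp
  qed
qed

lemma trail_system_exists:
  assumes "\<forall>e\<in>set es. fst e \<noteq> snd e"
  shows "\<exists>ts. trail_system ts (mset (map arc_edge es))"
  using assms
proof (induction es)
  case Nil
  show ?case by (rule exI[of _ "{}"]) (simp add: trail_system_def)
next
  case (Cons e es)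
  then obtain ts where "trail_system ts (mset (map arc_edge es))" by auto
  then obtain ts' where "trail_system ts' (add_mset {fst e, snd e} (mset (map arc_edge es)))"
    using trail_system_add_edge Cons.prems by (metis list.set_intros(1))
  then show ?case by (intro exI[of _ ts']) (simp add: arc_edge_def[of e])
qed

section \<open>Labelling trails to bound the vertex sums\<close>

lemma length_vwalk_arcs_Cons: "length (vwalk_arcs (w # p)) = length p"
  by (induction p arbitrary: w) auto

text \<open>
  Labelled downwards along a walk, each passage through an inner vertex enters with a label that
  is by 1 larger than the one it leaves with.
\<close>
lemma list_sum_descending:
  assumes "p \<noteq> []"
  shows "list_sum c (rev (vwalk_arcs (u # p))) v =
    int (count_list (butlast p) v) + int (c + 1) * of_bool (last p = v)
    - int (c + length p) * of_bool (u = v)"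
  using assms
proof (induction p arbitrary: u)
  case (Cons w p)
  show ?case
  proof (cases "p = []")
    case False
    then show ?thesis using Cons.IH[OF False, of w]
      by (simp add: list_sum_append signed_inc_def length_vwalk_arcs_Cons algebra_simps del: vwalk_arcs_Cons)
  qed (simp add: signed_inc_def)
qed simp

lemma out_count_vwalk: "out_count v (vwalk_arcs (u # p)) = count_list (butlast (u # p)) v"
  by (induction p arbitrary: u) (auto simp: out_count_def)

text \<open>
  The trail is cut at its inner vertices in \<open>A\<close>. Each piece is labelled downwards, and the pieces
  get increasing label ranges. So a passage at a vertex outside \<open>A\<close> contributes 1, and a passage at
  a vertex of \<open>A\<close>, where the trail moves on to the next piece, contributes a negative amount. Only
  the first arc, labelled \<open>j\<close>, and the last arc, labelled \<open>i\<close>, are left unpaired.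
\<close>
lemma trail_labelling:
  assumes "p \<noteq> []"
  shows "\<exists>es. mset es = mset (vwalk_arcs (u # p)) \<and>
    (\<forall>c. \<exists>i j. c < i \<and> i \<le> c + length es \<and> c < j \<and> j \<le> c + length es \<and>
      (\<forall>v. (v \<in> A \<longrightarrow> list_sum c es v \<le> int i * of_bool (last p = v) - int j * of_bool (u = v)) \<and>
           (v \<notin> A \<longrightarrow> (\<exists>k \<le> out_count v es.
              list_sum c es v = int k + int i * of_bool (last p = v) - int j * of_bool (u = v)))))"
  using assms
proof (induction "length p" arbitrary: u p rule: less_induct)
  case less
  have desc: "(v \<in> A \<longrightarrow> list_sum c es v \<le> int (c + 1) * of_bool (last q = v) - int (c + length q) * of_bool (u = v)) \<and>
           (v \<notin> A \<longrightarrow> (\<exists>k \<le> out_count v es. list_sum c es v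
                = int k + int (c + 1) * of_bool (last q = v) - int (c + length q) * of_bool (u = v)))"
    if "q \<noteq> []" "set (butlast q) \<inter> A = {}" "es = rev (vwalk_arcs (u # q))" for q c v es
  proof -
    have "out_count v es = count_list (butlast (u # q)) v"
      using that(3) by (metis out_count_mset mset_rev out_count_vwalk)
    then have "count_list (butlast q) v \<le> out_count v es" using that(1) by simp
    moreover have "v \<in> A \<Longrightarrow> count_list (butlast q) v = 0"
      using that(2) by (metis count_list_0_iff disjoint_iff)
    ultimately show ?thesis
      unfolding that(3) list_sum_descending[OF that(1)] using that(3) by (auto intro!: exI[of _ "count_list (butlast q) v"])
  qed
  show ?case
  proof (cases "set (butlast p) \<inter> A = {}")
    case True
    have "0 < length p" using less by simp
    define es where "es = rev (vwalk_arcs (u # p))"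
    have les: "length es = length p" by (simp add: es_def length_vwalk_arcs_Cons del: vwalk_arcs_Cons)
    show ?thesis
    proof (intro exI[of _ es] conjI allI)
      show "mset es = mset (vwalk_arcs (u # p))" by (simp add: es_def del: vwalk_arcs_Cons)
      fix c
      show "\<exists>i j. c < i \<and> i \<le> c + length es \<and> c < j \<and> j \<le> c + length es \<and>
        (\<forall>v. (v \<in> A \<longrightarrow> list_sum c es v \<le> int i * of_bool (last p = v) - int j * of_bool (u = v)) \<and>
           (v \<notin> A \<longrightarrow> (\<exists>k \<le> out_count v es.
              list_sum c es v = int k + int i * of_bool (last p = v) - int j * of_bool (u = v))))"
        by (intro exI[of _ "c + 1"] exI[of _ "c + length p"] conjI allI
              desc[OF less.prems True es_def, THEN conjunct1]
              desc[OF less.prems True es_def, THEN conjunct2])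
           (use les \<open>0 < length p\<close> in linarith)+
    qed
  next
    case False
    then have "\<exists>z\<in>set (butlast p). z \<in> A" by blast
    then obtain s z r where szr: "butlast p = s @ z # r" "z \<in> A" "set s \<inter> A = {}"
      by (elim split_list_first_propE) auto
    define r' where "r' = r @ [last p]"
    have p: "p = (s @ [z]) @ r'" using szr(1) less.prems r'_def
      by (metis append.assoc append_Cons append_Nil append_butlast_last_id)
    have "r' \<noteq> []" by (simp add: r'_def)
    obtain es where es: "mset es = mset (vwalk_arcs (z # r'))" and
      IH: "\<And>c. \<exists>i j. c < i \<and> i \<le> c + length es \<and> c < j \<and> j \<le> c + length es \<and>
      (\<forall>v. (v \<in> A \<longrightarrow> list_sum c es v \<le> int i * of_bool (last r' = v) - int j * of_bool (z = v)) \<and>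
           (v \<notin> A \<longrightarrow> (\<exists>k \<le> out_count v es.
              list_sum c es v = int k + int i * of_bool (last r' = v) - int j * of_bool (z = v))))"
      using less.hyps[of r' z] p \<open>r' \<noteq> []\<close> by auto
    define fs where "fs = rev (vwalk_arcs (u # s @ [z]))"
    have lfs: "length fs = length (s @ [z])" by (simp add: fs_def length_vwalk_arcs_Cons del: vwalk_arcs_Cons)
    have "vwalk_arcs (u # p) = vwalk_arcs (u # s @ [z]) @ vwalk_arcs (z # r')"
      using vwalk_arcs_append[of "u # s @ [z]" r'] \<open>r' \<noteq> []\<close> p by (cases r') auto
    then have m: "mset (fs @ es) = mset (vwalk_arcs (u # p))" using es
      by (simp add: fs_def del: vwalk_arcs_Cons)
    have lp: "last p = last r'" using p \<open>r' \<noteq> []\<close> by simp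
    show ?thesis
    proof (intro exI[of _ "fs @ es"] conjI allI m)
      fix c
      obtain i j where ij: "c + length fs < i" "i \<le> c + length fs + length es"
          "c + length fs < j" "j \<le> c + length fs + length es"
        and bd: "\<And>v. v \<in> A \<Longrightarrow> list_sum (c + length fs) es v \<le> int i * of_bool (last r' = v) - int j * of_bool (z = v)"
        "\<And>v. v \<notin> A \<Longrightarrow> \<exists>k \<le> out_count v es.
              list_sum (c + length fs) es v = int k + int i * of_bool (last r' = v) - int j * of_bool (z = v)"
        using IH[of "c + length fs"] by metis
      have d: "set (butlast (s @ [z])) \<inter> A = {}" using szr by simp
      have bA: "list_sum c (fs @ es) v \<le> int i * of_bool (last p = v) - int (c + length fs) * of_bool (u = v)"
        if "v \<in> A" for v
        using desc[OF _ d fs_def, of v c] bd(1)[OF that] that ij(3)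
        by (auto simp: list_sum_append lp lfs of_bool_def split: if_splits)
      have bB: "\<exists>k \<le> out_count v (fs @ es). list_sum c (fs @ es) v =
          int k + int i * of_bool (last p = v) - int (c + length fs) * of_bool (u = v)"
        if v: "v \<notin> A" for v
      proof -
        obtain k where k: "k \<le> out_count v es"
          "list_sum (c + length fs) es v = int k + int i * of_bool (last r' = v) - int j * of_bool (z = v)"
          using bd(2)[OF v] by blast
        obtain k' where k': "k' \<le> out_count v fs" "list_sum c fs v
                = int k' + int (c + 1) * of_bool (z = v) - int (c + length fs) * of_bool (u = v)"
          using desc[OF _ d fs_def, of v c] v lfs by auto
        have "z \<noteq> v" using v szr by auto
        then show ?thesis using k k'
          by (intro exI[of _ "k + k'"]) (auto simp: list_sum_append lp out_count_append)
      qed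
      show "\<exists>i j. c < i \<and> i \<le> c + length (fs @ es) \<and> c < j \<and> j \<le> c + length (fs @ es) \<and>
        (\<forall>v. (v \<in> A \<longrightarrow> list_sum c (fs @ es) v \<le> int i * of_bool (last p = v) - int j * of_bool (u = v)) \<and>
           (v \<notin> A \<longrightarrow> (\<exists>k \<le> out_count v (fs @ es).
              list_sum c (fs @ es) v = int k + int i * of_bool (last p = v) - int j * of_bool (u = v))))"
        using bA bB ij lfs
        by (intro exI[of _ i] exI[of _ "c + length fs"]) auto
    qed
  qed
qed


lemma trail_labelling_bounds:
  assumes "p \<noteq> []"
  shows "\<exists>es. mset es = mset (vwalk_arcs p) \<and>
    (\<forall>c v. (v \<in> A \<longrightarrow> list_sum c es v \<le> (if v \<in> ends p then int (c + length es) else 0)) \<and>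
       (v \<notin> A \<longrightarrow> list_sum c es v \<le> int (out_count v es) + (if v \<in> ends p then int (c + length es) else 0) \<and>
                   list_sum c es v \<ge> - (if v \<in> ends p then int (c + length es) else 0)))"
proof (cases "tl p = []")
  case True
  then have "vwalk_arcs p = []" by (metis assms list.collapse vwalk_arcs.simps(2))
  then show ?thesis by (intro exI[of _ "[]"]) auto
next
  case False
  obtain es where m: "mset es = mset (vwalk_arcs (hd p # tl p))" and
    es: "\<And>c. \<exists>i j. c < i \<and> i \<le> c + length es \<and> c < j \<and> j \<le> c + length es \<and>
      (\<forall>v. (v \<in> A \<longrightarrow> list_sum c es v \<le> int i * of_bool (last (tl p) = v) - int j * of_bool (hd p = v)) \<and>
           (v \<notin> A \<longrightarrow> (\<exists>k \<le> out_count v es.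
              list_sum c es v = int k + int i * of_bool (last (tl p) = v) - int j * of_bool (hd p = v))))"
    using trail_labelling[OF False, where u = "hd p" and A = A] by metis
  have l: "last (tl p) = last p" using False by (cases p) auto
  show ?thesis
  proof (intro exI[of _ es] conjI allI)
    show "mset es = mset (vwalk_arcs p)" using m assms by simp
    fix c v
    obtain i j where "c < i" "i \<le> c + length es" "c < j" "j \<le> c + length es" and
      ij: "v \<in> A \<Longrightarrow> list_sum c es v \<le> int i * of_bool (last p = v) - int j * of_bool (hd p = v)"
           "v \<notin> A \<Longrightarrow> \<exists>k \<le> out_count v es.
              list_sum c es v = int k + int i * of_bool (last p = v) - int j * of_bool (hd p = v)"
      using es[of c] unfolding l by metis
    then show "v \<in> A \<longrightarrow> list_sum c es v \<le> (if v \<in> ends p then int (c + length es) else 0)"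
      by (auto simp: ends_def of_bool_def split: if_splits)
    show "v \<notin> A \<longrightarrow> list_sum c es v \<le> int (out_count v es) + (if v \<in> ends p then int (c + length es) else 0) \<and>
                   list_sum c es v \<ge> - (if v \<in> ends p then int (c + length es) else 0)"
      using ij(2) \<open>c < i\<close> \<open>i \<le> c + length es\<close> \<open>c < j\<close> \<open>j \<le> c + length es\<close>
      by (auto simp: ends_def of_bool_def split: if_splits)
  qed
qed

lemma trail_system_labelling:
  assumes "distinct ps" "[] \<notin> set ps"
    and "\<forall>p\<in>set ps. \<forall>q\<in>set ps. p \<noteq> q \<longrightarrow> ends p \<inter> ends q = {}"
  shows "\<exists>es. mset (map arc_edge es) = (\<Sum>p\<in>set ps. trail_edges p) \<and>
    (\<forall>c v. (v \<in> A \<longrightarrow> list_sum c es v \<le> (if \<exists>p\<in>set ps. v \<in> ends p then int (c + length es) else 0)) \<and>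
       (v \<notin> A \<longrightarrow> list_sum c es v \<le> int (out_count v es) + (if \<exists>p\<in>set ps. v \<in> ends p then int (c + length es) else 0) \<and>
                   list_sum c es v \<ge> - (if \<exists>p\<in>set ps. v \<in> ends p then int (c + length es) else 0)))"
  using assms
proof (induction ps)
  case Nil
  show ?case by (rule exI[of _ "[]"]) simp
next
  case (Cons p ps)
  obtain es where es: "mset (map arc_edge es) = (\<Sum>p\<in>set ps. trail_edges p)"
    "\<And>c v. v \<in> A \<Longrightarrow> list_sum c es v \<le> (if \<exists>p\<in>set ps. v \<in> ends p then int (c + length es) else 0)"
    "\<And>c v. v \<notin> A \<Longrightarrow> list_sum c es v \<le> int (out_count v es) + (if \<exists>p\<in>set ps. v \<in> ends p then int (c + length es) else 0)"
    "\<And>c v. v \<notin> A \<Longrightarrow> list_sum c es v \<ge> - (if \<exists>p\<in>set ps. v \<in> ends p then int (c + length es) else 0)"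
    using Cons.IH Cons.prems by (auto 0 3)
  obtain fs where fs: "mset fs = mset (vwalk_arcs p)"
    "\<And>c v. v \<in> A \<Longrightarrow> list_sum c fs v \<le> (if v \<in> ends p then int (c + length fs) else 0)"
    "\<And>c v. v \<notin> A \<Longrightarrow> list_sum c fs v \<le> int (out_count v fs) + (if v \<in> ends p then int (c + length fs) else 0)"
    "\<And>c v. v \<notin> A \<Longrightarrow> list_sum c fs v \<ge> - (if v \<in> ends p then int (c + length fs) else 0)"
    using trail_labelling_bounds[of p A] Cons.prems(2) by auto
  have excl: "\<not> (\<exists>q\<in>set ps. v \<in> ends q)" if "v \<in> ends p" for v
    using that Cons.prems by fastforce
  have "mset (map arc_edge (fs @ es)) = (\<Sum>q\<in>set (p # ps). trail_edges q)"
    using es(1) fs(1) Cons.prems(1) by (simp add: trail_edges_def)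
  moreover have "list_sum c (fs @ es) v \<le> (if \<exists>q\<in>set (p # ps). v \<in> ends q then int (c + length (fs @ es)) else 0)"
    if "v \<in> A" for c v
    using es(2)[OF that, of "c + length fs"] fs(2)[OF that, of c] excl[of v]
    by (auto simp: list_sum_append split: if_splits)
  moreover have "list_sum c (fs @ es) v \<le> int (out_count v (fs @ es)) +
      (if \<exists>q\<in>set (p # ps). v \<in> ends q then int (c + length (fs @ es)) else 0)"
    if "v \<notin> A" for c v
    using es(3)[OF that, of "c + length fs"] fs(3)[OF that, of c] excl[of v]
    by (auto simp: list_sum_append out_count_append split: if_splits)
  moreover have "list_sum c (fs @ es) v \<ge>
      - (if \<exists>q\<in>set (p # ps). v \<in> ends q then int (c + length (fs @ es)) else 0)"
    if "v \<notin> A" for c v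
    using es(4)[OF that, of "c + length fs"] fs(4)[OF that, of c] excl[of v]
    by (auto simp: list_sum_append split: if_splits)
  ultimately show ?case by blast
qed

text \<open>
  At most one trail has an end at \<open>v\<close>, and its ends contribute at most the largest label
  \<open>c + length es\<close> in absolute value. All other arcs at \<open>v\<close> come in pairs of consecutive arcs of a
  trail. Each pair contributes a negative amount if \<open>v \<in> A\<close> and exactly 1 otherwise, and there are
  at most as many pairs as neighbours of \<open>v\<close>.
\<close>
theorem balanced_orientation:
  assumes fin: "finite H" and sym: "sym H" and irr: "irrefl H"
  shows "\<exists>es. distinct es \<and> set es \<subseteq> H \<and> (\<forall>u v. (u, v) \<in> H \<longrightarrow> ((u, v) \<in> set es \<longleftrightarrow> (v, u) \<notin> set es)) \<and>
    (\<forall>c v. (v \<in> A \<longrightarrow> list_sum c es v \<le> int (c + length es)) \<and>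
       (v \<notin> A \<longrightarrow> - int (c + length es) \<le> list_sum c es v \<and>
          list_sum c es v \<le> int (c + length es) + int (card {w. (v, w) \<in> H})))"
proof -
  define r where "r = (\<lambda>s. SOME e. e \<in> H \<and> arc_edge e = s)"
  have r: "r s \<in> H \<and> arc_edge (r s) = s" if "s \<in> arc_edge ` H" for s
    unfolding r_def by (rule someI_ex) (use that in blast)
  obtain ss where ss: "set ss = arc_edge ` H" "distinct ss"
    using finite_distinct_list[OF finite_imageI[OF fin]] by metis
  have "\<forall>e\<in>set (map r ss). fst e \<noteq> snd e"
  proof
    fix e assume "e \<in> set (map r ss)"
    then have "e \<in> H" using r ss(1) by auto
    then show "fst e \<noteq> snd e" using irr by (cases e) (auto simp: irrefl_def)
  qed
  then obtain ts where ts: "trail_system ts (mset (map arc_edge (map r ss)))"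
    using trail_system_exists by blast
  have eq: "map arc_edge (map r ss) = ss" unfolding map_map by (rule map_idI) (use r ss(1) in auto)
  have ts: "trail_system ts (mset ss)" using ts unfolding eq .
  obtain ps where ps: "set ps = ts" "distinct ps"
    using ts finite_distinct_list unfolding trail_system_def by metis
  obtain es where es: "mset (map arc_edge es) = mset ss" and
    bd: "\<And>c v. v \<in> A \<Longrightarrow> list_sum c es v \<le> (if \<exists>p\<in>set ps. v \<in> ends p then int (c + length es) else 0)"
    "\<And>c v. v \<notin> A \<Longrightarrow> list_sum c es v \<le> int (out_count v es) + (if \<exists>p\<in>set ps. v \<in> ends p then int (c + length es) else 0)"
    "\<And>c v. v \<notin> A \<Longrightarrow> list_sum c es v \<ge> - (if \<exists>p\<in>set ps. v \<in> ends p then int (c + length es) else 0)"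
    using trail_system_labelling[of ps A] ps ts unfolding trail_system_def by auto
  have d: "distinct (map arc_edge es)" using es ss(2) by (metis mset_eq_imp_distinct_iff)
  have im: "arc_edge ` set es = arc_edge ` H" using es ss(1) by (metis list.set_map mset_eq_setD)
  have flip: "(v, u) \<in> H" if "(u, v) \<in> H" for u v using sym that by (auto dest: symD)
  have ae: "e = (u, v) \<or> e = (v, u)" if "arc_edge e = {u, v}" for e and u v :: 'a
    using that by (cases e) (auto simp: arc_edge_def doubleton_eq_iff)
  have sub: "set es \<subseteq> H"
  proof
    fix e assume "e \<in> set es"
    then have "arc_edge e \<in> arc_edge ` H" using im by blast
    then obtain u v where "(u, v) \<in> H" "arc_edge e = {u, v}" by (auto simp: arc_edge_def)
    then show "e \<in> H" using ae flip by blast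
  qed
  have ori: "(u, v) \<in> set es \<longleftrightarrow> (v, u) \<notin> set es" if uv: "(u, v) \<in> H" for u v
  proof -
    have "arc_edge (u, v) \<in> arc_edge ` set es" using im uv by blast
    then obtain e where e: "e \<in> set es" "arc_edge e = {u, v}" by (auto simp: arc_edge_def)
    have "inj_on arc_edge (set es)" using d by (simp add: distinct_map)
    moreover have "u \<noteq> v" using irr uv by (auto simp: irrefl_def)
    moreover have "arc_edge (u, v) = arc_edge (v, u)" by (auto simp: arc_edge_def)
    ultimately have "\<not> ((u, v) \<in> set es \<and> (v, u) \<in> set es)" by (metis inj_onD prod.inject)
    then show ?thesis using e ae by blast
  qed
  have deg: "out_count v es \<le> card {w. (v, w) \<in> H}" for v
  proof -
    have "out_count v es = card {e \<in> set es. fst e = v}"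
      using d by (simp add: out_count_def distinct_map flip: set_filter distinct_card)
    also have "\<dots> = card (snd ` {e \<in> set es. fst e = v})"
      by (rule card_image[symmetric]) (auto simp: inj_on_def)
    also have "\<dots> \<le> card {w. (v, w) \<in> H}"
    proof (rule card_mono)
      have "{w. (v, w) \<in> H} \<subseteq> snd ` H" by force
      then show "finite {w. (v, w) \<in> H}" using fin finite_subset by blast
    qed (use sub in auto)
    finally show ?thesis .
  qed
  have "list_sum c es v \<le> int (c + length es)" if "v \<in> A" for c v
    using bd(1)[OF that, of c] by (auto split: if_splits)
  moreover have "- int (c + length es) \<le> list_sum c es v" if "v \<notin> A" for c v
    using bd(3)[OF that, of c] by (auto split: if_splits)
  moreover have "list_sum c es v \<le> int (c + length es) + int (card {w. (v, w) \<in> H})" if "v \<notin> A" for c v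
    using bd(2)[OF that, of c] deg[of v] by (auto split: if_splits)
  ultimately show ?thesis using d sub ori by (intro exI[of _ es]) (auto simp: distinct_map)
qed

section \<open>Vertex sums of labelled arc sets\<close>

definition net :: "('a \<times> 'a) set \<Rightarrow> ('a \<times> 'a \<Rightarrow> nat) \<Rightarrow> 'a \<Rightarrow> int" where
  "net D \<tau> u = (\<Sum>e | e \<in> D \<and> snd e = u. int (\<tau> e)) - (\<Sum>e | e \<in> D \<and> fst e = u. int (\<tau> e))"

lemma vertex_sum_eq_net: "vertex_sum D \<tau> u = net (parcs D) \<tau> u"
  by (simp add: vertex_sum_def net_def in_arcs_def out_arcs_def)

lemma net_union:
  assumes "finite E" "finite F" "E \<inter> F = {}"
  shows "net (E \<union> F) \<tau> u = net E \<tau> u + net F \<tau> u"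
proof -
  have "{e. e \<in> E \<union> F \<and> Q e} = {e. e \<in> E \<and> Q e} \<union> {e. e \<in> F \<and> Q e}" for Q by auto
  moreover have "(\<Sum>e\<in>{e. e \<in> E \<and> Q e} \<union> {e. e \<in> F \<and> Q e}. int (\<tau> e))
      = (\<Sum>e | e \<in> E \<and> Q e. int (\<tau> e)) + (\<Sum>e | e \<in> F \<and> Q e. int (\<tau> e))" for Q
    using assms by (intro sum.union_disjoint) auto
  ultimately show ?thesis by (simp add: net_def)
qed

lemma net_cong: "(\<And>e. e \<in> D \<Longrightarrow> \<tau> e = \<tau>' e) \<Longrightarrow> net D \<tau> u = net D \<tau>' u"
  unfolding net_def by (intro arg_cong2[of _ _ _ _ "(-)"] sum.cong) auto

lemma net_single: "net {e} \<tau> u = int (\<tau> e) * signed_inc u e"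
proof -
  have "{e'. e' \<in> {e} \<and> Q e'} = (if Q e then {e} else {})" for Q by auto
  then show ?thesis by (simp add: net_def signed_inc_def)
qed

lemma net_list:
  "distinct es \<Longrightarrow> map \<tau> es = [Suc c..<Suc c + length es] \<Longrightarrow> net (set es) \<tau> u = list_sum c es u"
proof (induction es arbitrary: c)
  case (Cons e es)
  have "map \<tau> es = [Suc (Suc c)..<Suc (Suc c) + length es]" "\<tau> e = Suc c"
    using Cons.prems(2) by (auto simp: upt_conv_Cons simp del: upt_Suc)
  moreover have "net (insert e (set es)) \<tau> u = net {e} \<tau> u + net (set es) \<tau> u"
    using Cons.prems(1) net_union[of "{e}" "set es" \<tau> u] by simp
  ultimately show ?case using Cons.IH[of "Suc c"] Cons.prems(1) by (simp add: net_single del: upt_Suc)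
qed (simp add: net_def)

lemma net_image_left:
  assumes "finite Z"
  shows "net ((\<lambda>z. (p z, z)) ` Z) \<tau> u =
    (if u \<in> Z then int (\<tau> (p u, u)) else 0) - (\<Sum>z | z \<in> Z \<and> p z = u. int (\<tau> (p z, z)))"
proof -
  have 1: "{e. e \<in> (\<lambda>z. (p z, z)) ` Z \<and> snd e = u} = (if u \<in> Z then {(p u, u)} else {})" by auto
  have 2: "{e. e \<in> (\<lambda>z. (p z, z)) ` Z \<and> fst e = u} = (\<lambda>z. (p z, z)) ` {z. z \<in> Z \<and> p z = u}" by auto
  have "(\<Sum>e\<in>(\<lambda>z. (p z, z)) ` {z. z \<in> Z \<and> p z = u}. int (\<tau> e)) = (\<Sum>z | z \<in> Z \<and> p z = u. int (\<tau> (p z, z)))"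
    by (subst sum.reindex) (auto simp: inj_on_def)
  then show ?thesis by (simp only: net_def 1 2) simp
qed

lemma net_image_right:
  assumes "finite Z"
  shows "net ((\<lambda>z. (z, p z)) ` Z) \<tau> u =
    (\<Sum>z | z \<in> Z \<and> p z = u. int (\<tau> (z, p z))) - (if u \<in> Z then int (\<tau> (u, p u)) else 0)"
proof -
  have 1: "{e. e \<in> (\<lambda>z. (z, p z)) ` Z \<and> fst e = u} = (if u \<in> Z then {(u, p u)} else {})" by auto
  have 2: "{e. e \<in> (\<lambda>z. (z, p z)) ` Z \<and> snd e = u} = (\<lambda>z. (z, p z)) ` {z. z \<in> Z \<and> p z = u}" by auto
  have "(\<Sum>e\<in>(\<lambda>z. (z, p z)) ` {z. z \<in> Z \<and> p z = u}. int (\<tau> e)) = (\<Sum>z | z \<in> Z \<and> p z = u. int (\<tau> (z, p z)))"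
    by (subst sum.reindex) (auto simp: inj_on_def)
  then show ?thesis by (simp only: net_def 1 2) simp
qed

text \<open>
  Larger values of \<open>w\<close> receive larger elements of \<open>T\<close>; then even ties in \<open>w\<close> are broken.
\<close>
lemma sorted_assignment:
  fixes w :: "'b \<Rightarrow> int" and T :: "nat set"
  assumes "finite V" "finite T" "card V = card T"
  shows "\<exists>f. bij_betw f V T \<and> inj_on (\<lambda>v. w v + int (f v)) V"
  using assms
proof (induction "card V" arbitrary: V T)
  case 0
  then show ?case by (auto simp: bij_betw_def)
next
  case (Suc n)
  have "V \<noteq> {}" "T \<noteq> {}" using Suc by auto
  have "Max (w ` V) \<in> w ` V" using Suc.prems(1) \<open>V \<noteq> {}\<close> by (intro Max_in) auto
  then obtain v where vV: "v \<in> V" "w v = Max (w ` V)" by auto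
  then have v: "v \<in> V" "\<And>u. u \<in> V \<Longrightarrow> w u \<le> w v" using Suc.prems(1) by auto
  define t where "t = Max T"
  have t: "t \<in> T" "\<And>s. s \<in> T \<Longrightarrow> s \<le> t" using Suc \<open>T \<noteq> {}\<close> by (auto simp: t_def)
  obtain f where f: "bij_betw f (V - {v}) (T - {t})" "inj_on (\<lambda>u. w u + int (f u)) (V - {v})"
  proof -
    have "n = card (V - {v})" "card (V - {v}) = card (T - {t})"
      using Suc.hyps(2) Suc.prems v(1) t(1) by (simp_all add: card_Diff_singleton)
    then show ?thesis using that Suc.hyps(1)[of "V - {v}" "T - {t}"] Suc.prems by auto
  qed
  define g where "g = f(v := t)"
  have less: "w u + int (g u) < w v + int (g v)" if "u \<in> V - {v}" for u
  proof -
    have "f u \<in> T - {t}" using f(1) that by (auto simp: bij_betw_def)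
    then have "f u < t" using t(2)[of "f u"] by auto
    then show ?thesis using v(2)[of u] that by (auto simp: g_def)
  qed
  have "bij_betw g (V - {v}) (T - {t})"
    by (subst bij_betw_cong[of _ _ f]) (use f(1) in \<open>auto simp: g_def\<close>)
  then have "bij_betw g (insert v (V - {v})) (insert t (T - {t}))"
    using notIn_Un_bij_betw[of v "V - {v}" g "T - {t}"] by (simp add: g_def)
  moreover have "inj_on (\<lambda>u. w u + int (g u)) (insert v (V - {v}))"
  proof -
    have "inj_on (\<lambda>u. w u + int (g u)) (V - {v})"
      by (subst inj_on_cong[of _ _ "\<lambda>u. w u + int (f u)"]) (use f(2) in \<open>auto simp: g_def\<close>)
    then show ?thesis using less by (fastforce simp: inj_on_insert)
  qed
  ultimately show ?case using v(1) t(1) by (metis insert_Diff)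
qed

text \<open>
  Permuting the labels of arcs that leave \<open>y\<close> changes sums only at the heads of these arcs; at \<open>y\<close>
  itself they enter only through their total.
\<close>
lemma redistribute_out_labels:
  fixes \<tau> :: "'a \<times> 'a \<Rightarrow> nat"
  assumes fin: "finite D" and Z: "\<And>z. z \<in> Z \<Longrightarrow> (y, z) \<in> D" and y: "y \<notin> Z"
    and \<tau>: "bij_betw \<tau> D T" and f: "bij_betw f Z ((\<lambda>z. \<tau> (y, z)) ` Z)"
  defines "\<tau>' \<equiv> \<lambda>e. if fst e = y \<and> snd e \<in> Z then f (snd e) else \<tau> e"
  shows "bij_betw \<tau>' D T"
    and "\<And>z. z \<in> Z \<Longrightarrow> net D \<tau>' z = net D \<tau> z - int (\<tau> (y, z)) + int (f z)"
    and "\<And>u. u \<notin> Z \<Longrightarrow> net D \<tau>' u = net D \<tau> u"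
proof -
  define E where "E = (\<lambda>z. (y, z)) ` Z"
  have "E \<subseteq> D" using Z by (auto simp: E_def)
  then have D: "D = (D - E) \<union> E" and finE: "finite E" using fin finite_subset by auto
  then have finZ: "finite Z" using finite_imageD[of "\<lambda>z. (y, z)" Z] by (auto simp: E_def inj_on_def)
  have out: "\<tau>' e = \<tau> e" if "e \<in> D - E" for e using that by (cases e) (auto simp: \<tau>'_def E_def)
  have inn: "\<tau>' (y, z) = f z" if "z \<in> Z" for z using that by (simp add: \<tau>'_def)
  have "bij_betw (\<lambda>z. \<tau>' (y, z)) Z ((\<lambda>z. \<tau> (y, z)) ` Z)"
    by (subst bij_betw_cong[of _ _ f]) (use f inn in auto)
  then have "bij_betw \<tau>' E (\<tau> ` E)"
    by (auto simp: E_def bij_betw_def inj_on_def image_image)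
  moreover have "bij_betw \<tau>' (D - E) (\<tau> ` (D - E))"
    by (subst bij_betw_cong[of _ _ \<tau>]) (use out \<tau> in \<open>auto simp: bij_betw_def inj_on_def\<close>)
  moreover have "\<tau> ` E \<inter> \<tau> ` (D - E) = {}"
    using \<tau> \<open>E \<subseteq> D\<close> by (auto simp: bij_betw_def inj_on_def)
  moreover have "\<tau> ` (D - E) \<union> \<tau> ` E = T" using \<tau> D by (metis bij_betw_def image_Un)
  ultimately show "bij_betw \<tau>' D T" using bij_betw_combine[of \<tau>' "D - E" "\<tau> ` (D - E)" E "\<tau> ` E"] D
    by (simp add: inf_commute)
  have split: "net D \<sigma> u = net (D - E) \<sigma> u + net E \<sigma> u" for \<sigma> u
    using net_union[of "D - E" E \<sigma> u] fin finE D by auto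
  have rest: "net (D - E) \<tau>' u = net (D - E) \<tau> u" for u by (rule net_cong) (rule out)
  have E: "net E \<sigma> u = (if u \<in> Z then int (\<sigma> (y, u)) else 0) - (if y = u then (\<Sum>z\<in>Z. int (\<sigma> (y, z))) else 0)" for \<sigma> u
    using net_image_left[OF finZ, of "\<lambda>_. y" \<sigma> u] by (simp add: E_def)
  have "(\<Sum>z\<in>Z. int (\<tau>' (y, z))) = (\<Sum>z\<in>Z. int (f z))" using inn by simp
  also have "\<dots> = (\<Sum>t\<in>(\<lambda>z. \<tau> (y, z)) ` Z. int t)" by (rule sum.reindex_bij_betw[OF f])
  also have "\<dots> = (\<Sum>z\<in>Z. int (\<tau> (y, z)))"
  proof -
    have "inj_on (\<lambda>z. \<tau> (y, z)) Z" using \<tau> Z by (force simp: bij_betw_def inj_on_def)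
    then show ?thesis by (simp add: sum.reindex)
  qed
  finally have sums: "(\<Sum>z\<in>Z. int (\<tau>' (y, z))) = (\<Sum>z\<in>Z. int (\<tau> (y, z)))" .
  show "net D \<tau>' z = net D \<tau> z - int (\<tau> (y, z)) + int (f z)" if "z \<in> Z" for z
    using that y split[of \<tau> z] split[of \<tau>' z] rest[of z] E[of \<tau> z] E[of \<tau>' z] inn[of z] by auto
  show "net D \<tau>' u = net D \<tau> u" if "u \<notin> Z" for u
    using that split[of \<tau> u] split[of \<tau>' u] rest[of u] E[of \<tau> u] E[of \<tau>' u] sums by auto
qed

lemma relabel_list:
  assumes "distinct xs" "length xs = length ys"
  shows "\<exists>t. map t xs = ys"
  using assms by (intro exI[of _ "\<lambda>x. the (map_of (zip xs ys) x)"])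
    (simp add: list_eq_iff_nth_eq map_of_zip_nth)

lemma reverse_arc:
  assumes "pair_graph G" "(u, v) \<in> parcs G"
  shows "(v, u) \<in> parcs G"
proof -
  interpret pair_graph G by fact
  show ?thesis using pair_sym_arcs assms(2)
    by (auto simp: symmetric_def sym_def with_proj_simps arcs_ends_def arc_to_ends_def)
qed

lemma card_edges_orientation:
  assumes "pair_graph G" "is_orientation G D"
  shows "card (edges G) = card (parcs D)"
proof -
  interpret pair_graph G by fact
  have ori: "(u, v) \<in> parcs D \<longleftrightarrow> (v, u) \<notin> parcs D" if "(u, v) \<in> parcs G" for u v
    using assms(2) that by (auto simp: is_orientation_def)
  have sub: "parcs D \<subseteq> parcs G" using assms(2) by (simp add: is_orientation_def)
  have "edges G = arc_edge ` parcs D"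
    using ori sub by (fastforce simp: edges_def arc_edge_def image_iff Bex_def insert_commute)
  moreover have "inj_on arc_edge (parcs D)"
    using ori sub by (fastforce simp: inj_on_def arc_edge_def doubleton_eq_iff)
  ultimately show ?thesis by (simp add: card_image)
qed

lemma antimagicI:
  assumes "is_orientation G \<lparr>pverts = pverts G, parcs = D\<rparr>" "bij_betw \<tau> D {1..m}"
    and "inj_on (net D \<tau>) (pverts G)"
  shows "\<exists>D \<tau>. antimagic_orientation G (D, \<tau>)"
proof (intro exI)
  have "card D = m" using bij_betw_same_card[OF assms(2)] by simp
  then show "antimagic_orientation G (\<lparr>pverts = pverts G, parcs = D\<rparr>, \<tau>)"
    using assms by (auto simp: antimagic_orientation_def antimagic_labeling_def vertex_sum_eq_net inj_on_def)
qed

text \<open>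
  The single out-neighbour \<open>z\<close> reflects that the edges between at most three centres can be
  oriented with at most one arc leaving each centre.
\<close>
lemma net_lower_bound:
  assumes fin: "finite D" and Y: "card Y = 3" "\<And>y. y \<in> Y \<Longrightarrow> (y, x) \<in> D \<and> M \<le> \<tau> (y, x)"
    and out: "{e \<in> D. fst e = x} \<subseteq> {(x, z)}" "(x, z) \<in> D \<Longrightarrow> \<tau> (x, z) \<le> r"
  shows "3 * int M - int r \<le> net D \<tau> x"
proof -
  have "3 * int M \<le> (\<Sum>y\<in>Y. int (\<tau> (y, x)))"
    using sum_bounded_below[of Y "int M" "\<lambda>y. int (\<tau> (y, x))"] Y by simp
  also have "\<dots> = (\<Sum>e\<in>(\<lambda>y. (y, x)) ` Y. int (\<tau> e))" by (subst sum.reindex) (auto simp: inj_on_def)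
  also have "\<dots> \<le> (\<Sum>e | e \<in> D \<and> snd e = x. int (\<tau> e))"
    by (rule sum_mono2) (use fin Y in auto)
  finally have 1: "3 * int M \<le> (\<Sum>e | e \<in> D \<and> snd e = x. int (\<tau> e))" .
  have "{e. e \<in> D \<and> fst e = x} = (if (x, z) \<in> D then {(x, z)} else {})" using out(1) by auto
  then have "(\<Sum>e | e \<in> D \<and> fst e = x. int (\<tau> e)) \<le> int r" using out(2) by simp
  with 1 show ?thesis by (simp add: net_def)
qed

section \<open>Graphs within distance two of a set of centres\<close>

text \<open>
  \<open>X\<close> is the set of centres, \<open>A\<close> the first layer and \<open>B\<close> the second layer around them; \<open>\<sigma>\<close> and
  \<open>\<pi>\<close> choose for each vertex of a layer a neighbour in the layer below.
\<close>
locale layered_graph =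
  fixes G :: "'a pair_pre_digraph" and A B X :: "'a set" and \<sigma> \<pi> :: "'a \<Rightarrow> 'a"
  assumes graph: "pair_graph G"
    and verts: "pverts G = A \<union> B \<union> X"
    and disj: "A \<inter> B = {}" "A \<inter> X = {}" "B \<inter> X = {}"
    and star: "\<And>a. a \<in> A \<Longrightarrow> \<sigma> a \<in> X \<and> (a, \<sigma> a) \<in> parcs G"
    and twig: "\<And>b. b \<in> B \<Longrightarrow> \<pi> b \<in> A \<and> (\<pi> b, b) \<in> parcs G"
    and no_shortcut: "\<And>b x. b \<in> B \<Longrightarrow> x \<in> X \<Longrightarrow> (b, x) \<notin> parcs G"
begin

sublocale pair_graph G by (rule graph)

definition inner_arcs :: "('a \<times> 'a) set" where
  "inner_arcs = {(u, v) \<in> parcs G. u \<in> A \<union> B \<and> v \<in> A \<union> B \<and>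
     \<not> (v \<in> B \<and> u = \<pi> v) \<and> \<not> (u \<in> B \<and> v = \<pi> u)}"

definition star_arcs :: "('a \<times> 'a) set" where
  "star_arcs = (\<lambda>a. (a, \<sigma> a)) ` A"

definition twig_arcs :: "('a \<times> 'a) set" where
  "twig_arcs = (\<lambda>b. (\<pi> b, b)) ` B"

text \<open>
  An enumeration of the oriented inner edges, in the order of their labels, as provided by
  \<open>balanced_orientation\<close>.
\<close>
definition inner_list :: "('a \<times> 'a) list \<Rightarrow> bool" where
  "inner_list hs \<longleftrightarrow> distinct hs \<and> set hs \<subseteq> inner_arcs \<and>
     (\<forall>u v. (u, v) \<in> inner_arcs \<longrightarrow> ((u, v) \<in> set hs \<longleftrightarrow> (v, u) \<notin> set hs)) \<and>
     (\<forall>c v. (v \<in> A \<longrightarrow> list_sum c hs v \<le> int (c + length hs)) \<and>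
       (v \<notin> A \<longrightarrow> - int (c + length hs) \<le> list_sum c hs v \<and>
          list_sum c hs v \<le> int (c + length hs) + int (card {w. (v, w) \<in> inner_arcs})))"

text \<open>
  An enumeration of the edges at \<open>X\<close> other than the star arcs, those between \<open>A\<close> and \<open>X\<close> directed
  to \<open>X\<close> and those inside \<open>X\<close> directed arbitrarily. Like the inner arcs, they get small labels.
\<close>
definition outer_list :: "('a \<times> 'a) list \<Rightarrow> bool" where
  "outer_list cs \<longleftrightarrow> distinct cs \<and> set cs \<subseteq> parcs G \<and>
     (\<forall>e\<in>set cs. fst e \<in> A \<union> X \<and> snd e \<in> X \<and> e \<notin> star_arcs) \<and>
     (\<forall>a\<in>A. \<forall>x\<in>X. (a, x) \<in> parcs G \<longrightarrow> x \<noteq> \<sigma> a \<longrightarrow> (a, x) \<in> set cs) \<and>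
     (\<forall>x\<in>X. \<forall>y\<in>X. (x, y) \<in> parcs G \<longrightarrow> ((x, y) \<in> set cs \<longleftrightarrow> (y, x) \<notin> set cs))"

lemma finite_parts: "finite A" "finite B" "finite X"
  using pair_finite_verts verts by auto

lemmas arc_sym = reverse_arc[OF graph]

lemma inner_list_exists: "\<exists>hs. inner_list hs"
proof -
  have "finite inner_arcs" using pair_finite_arcs by (rule finite_subset[rotated]) (auto simp: inner_arcs_def)
  moreover have "sym inner_arcs" using arc_sym by (auto simp: sym_def inner_arcs_def)
  moreover have "irrefl inner_arcs" using pair_no_loops by (fastforce simp: irrefl_def inner_arcs_def)
  ultimately show ?thesis
    using balanced_orientation[of inner_arcs A] unfolding inner_list_def by blast
qed

definition all_arcs :: "('a \<times> 'a) list \<Rightarrow> ('a \<times> 'a) set" where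
  "all_arcs es = set es \<union> twig_arcs \<union> star_arcs"

lemma all_arcs_orientation:
  assumes "inner_list hs" "outer_list (pre @ post)"
  shows "is_orientation G \<lparr>pverts = pverts G, parcs = all_arcs (pre @ hs @ post)\<rparr>"
proof -
  let ?D = "all_arcs (pre @ hs @ post)"
  have hs: "set hs \<subseteq> inner_arcs" "\<And>u v. (u, v) \<in> inner_arcs \<Longrightarrow> (u, v) \<in> set hs \<longleftrightarrow> (v, u) \<notin> set hs"
    using assms(1) by (auto simp: inner_list_def)
  define cs where "cs = set (pre @ post)"
  have D: "?D = cs \<union> set hs \<union> twig_arcs \<union> star_arcs" by (auto simp: all_arcs_def cs_def)
  have cs1: "cs \<subseteq> parcs G" "\<forall>e\<in>cs. fst e \<in> A \<union> X \<and> snd e \<in> X \<and> e \<notin> star_arcs"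
    using assms(2) unfolding outer_list_def cs_def by blast+
  have cs: "cs \<subseteq> parcs G" "\<And>u v. (u, v) \<in> cs \<Longrightarrow> u \<in> A \<union> X \<and> v \<in> X \<and> (u, v) \<notin> star_arcs"
    using cs1 by auto
  have cs34: "\<And>a x. a \<in> A \<Longrightarrow> x \<in> X \<Longrightarrow> (a, x) \<in> parcs G \<Longrightarrow> x \<noteq> \<sigma> a \<Longrightarrow> (a, x) \<in> cs"
    "\<And>x y. x \<in> X \<Longrightarrow> y \<in> X \<Longrightarrow> (x, y) \<in> parcs G \<Longrightarrow> (x, y) \<in> cs \<longleftrightarrow> (y, x) \<notin> cs"
    using assms(2) unfolding outer_list_def cs_def by blast+
  note cs = cs cs34
  have memh: "(u, v) \<in> set hs \<Longrightarrow> u \<in> A \<union> B \<and> v \<in> A \<union> B \<and> \<not> (v \<in> B \<and> u = \<pi> v) \<and> \<not> (u \<in> B \<and> v = \<pi> u)" for u v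
    using hs(1) by (auto simp: inner_arcs_def)
  have memt: "(u, v) \<in> twig_arcs \<longleftrightarrow> v \<in> B \<and> u = \<pi> v" for u v by (auto simp: twig_arcs_def)
  have mems: "(u, v) \<in> star_arcs \<longleftrightarrow> u \<in> A \<and> v = \<sigma> u" for u v by (auto simp: star_arcs_def)
  have sub: "?D \<subseteq> parcs G"
    using cs(1) hs(1) star twig by (auto simp: D inner_arcs_def twig_arcs_def star_arcs_def)
  have iff: "(u, v) \<in> ?D \<longleftrightarrow> (v, u) \<notin> ?D" if uv: "(u, v) \<in> parcs G" for u v
  proof -
    have V: "u \<in> A \<union> B \<union> X" "v \<in> A \<union> B \<union> X" using wellformed[OF uv] verts by auto
    have vu: "(v, u) \<in> parcs G" using uv by (rule arc_sym)
    have XnAB: "\<And>x. x \<in> X \<Longrightarrow> x \<notin> A \<and> x \<notin> B" "\<And>x. x \<in> B \<Longrightarrow> x \<notin> A" using disj by auto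
    have s: "\<And>a. a \<in> A \<Longrightarrow> \<sigma> a \<in> X" "\<And>b. b \<in> B \<Longrightarrow> \<pi> b \<in> A" using star twig by auto
    consider (XX) "u \<in> X" "v \<in> X" | (AX) "u \<in> A" "v \<in> X" | (XA) "u \<in> X" "v \<in> A"
      | (inn) "u \<in> A \<union> B" "v \<in> A \<union> B"
      using V no_shortcut[of u v] no_shortcut[of v u] uv vu by blast
    then show ?thesis
    proof cases
      case XX
      then have "(u, v) \<notin> set hs \<union> twig_arcs \<union> star_arcs" "(v, u) \<notin> set hs \<union> twig_arcs \<union> star_arcs"
        using memh[of u v] memh[of v u] memt mems XnAB by blast+
      then show ?thesis using cs(4)[OF XX uv] by (auto simp: D)
    next
      case AX
      then have "(v, u) \<notin> ?D" using memh[of v u] memt mems XnAB cs(2)[of v u] s unfolding D by blast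
      moreover have "(u, v) \<in> ?D" using cs(3)[OF AX uv] mems AX unfolding D by blast
      ultimately show ?thesis by simp
    next
      case XA
      then have "(u, v) \<notin> ?D" using memh[of u v] memt mems XnAB cs(2)[of u v] s unfolding D by blast
      moreover have "(v, u) \<in> ?D" using cs(3)[OF XA(2,1) vu] mems XA unfolding D by blast
      ultimately show ?thesis by simp
    next
      case inn
      then have ncs: "(u, v) \<notin> cs \<union> star_arcs" "(v, u) \<notin> cs \<union> star_arcs"
        using inn cs(2)[of u v] cs(2)[of v u] XnAB(1)[of u] XnAB(1)[of v] s(1)[of u] s(1)[of v]
        by (auto simp: mems)
      show ?thesis
      proof (cases "(u, v) \<in> inner_arcs")
        case True
        then have "(u, v) \<notin> twig_arcs" "(v, u) \<notin> twig_arcs" by (auto simp: inner_arcs_def memt)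
        then show ?thesis using ncs hs(2)[OF True] by (auto simp: D)
      next
        case False
        then have "(u, v) \<notin> set hs" "(v, u) \<notin> set hs" "(u, v) \<in> twig_arcs \<or> (v, u) \<in> twig_arcs"
          using memh[of u v] memh[of v u] inn uv by (auto simp: inner_arcs_def memt)
        moreover have "\<not> ((u, v) \<in> twig_arcs \<and> (v, u) \<in> twig_arcs)"
          using s XnAB by (auto simp: memt)
        ultimately show ?thesis using ncs by (auto simp: D)
      qed
    qed
  qed
  show ?thesis using sub iff by (auto simp: is_orientation_def)
qed

lemma all_arcs_disjoint:
  assumes "inner_list hs" "outer_list (pre @ post)"
  shows "distinct (pre @ hs @ post)" "set (pre @ hs @ post) \<inter> twig_arcs = {}"
    "(set (pre @ hs @ post) \<union> twig_arcs) \<inter> star_arcs = {}"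
proof -
  have hs: "set hs \<subseteq> inner_arcs" "distinct hs" using assms(1) by (auto simp: inner_list_def)
  have cs: "distinct (pre @ post)" "\<And>e. e \<in> set (pre @ post) \<Longrightarrow> fst e \<in> A \<union> X \<and> snd e \<in> X \<and> e \<notin> star_arcs"
    using assms(2) by (auto simp: outer_list_def)
  have inn: "\<And>e. e \<in> inner_arcs \<Longrightarrow> snd e \<notin> X \<and> e \<notin> twig_arcs"
    using disj by (auto simp: inner_arcs_def twig_arcs_def)
  have st: "\<And>e. e \<in> star_arcs \<Longrightarrow> snd e \<in> X" using star by (auto simp: star_arcs_def)
  have tw: "\<And>e. e \<in> twig_arcs \<Longrightarrow> snd e \<notin> X" using disj by (auto simp: twig_arcs_def)
  have "set (pre @ post) \<inter> set hs = {}" using cs(2) hs(1) inn by blast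
  then show "distinct (pre @ hs @ post)" using cs(1) hs(2) by auto
  show "set (pre @ hs @ post) \<inter> twig_arcs = {}" using cs(2) hs(1) inn tw by fastforce
  show "(set (pre @ hs @ post) \<union> twig_arcs) \<inter> star_arcs = {}" using cs(2) hs(1) inn tw st by fastforce
qed

lemma net_all_arcs:
  assumes "inner_list hs" "outer_list (pre @ post)"
    and low: "map \<tau> (pre @ hs @ post) = [1..<Suc (length (pre @ hs @ post))]"
  shows "net (all_arcs (pre @ hs @ post)) \<tau> u = list_sum 0 (pre @ hs @ post) u
    + ((if u \<in> B then int (\<tau> (\<pi> u, u)) else 0) - (\<Sum>b | b \<in> B \<and> \<pi> b = u. int (\<tau> (\<pi> b, b))))
    + ((\<Sum>a | a \<in> A \<and> \<sigma> a = u. int (\<tau> (a, \<sigma> a))) - (if u \<in> A then int (\<tau> (u, \<sigma> u)) else 0))"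
proof -
  let ?L = "pre @ hs @ post"
  note d = all_arcs_disjoint[OF assms(1,2)]
  have fin: "finite twig_arcs" "finite star_arcs" using finite_parts by (auto simp: twig_arcs_def star_arcs_def)
  have "net (all_arcs ?L) \<tau> u = net (set ?L) \<tau> u + net twig_arcs \<tau> u + net star_arcs \<tau> u"
    unfolding all_arcs_def using net_union[of "set ?L \<union> twig_arcs" star_arcs \<tau> u]
      net_union[of "set ?L" twig_arcs \<tau> u] d fin by simp
  moreover have "net (set ?L) \<tau> u = list_sum 0 ?L u"
    using d(1) low by (intro net_list) (simp_all del: upt_Suc)
  ultimately show ?thesis
    using net_image_left[OF finite_parts(2), of \<pi> \<tau> u] net_image_right[OF finite_parts(1), of \<sigma> \<tau> u]
    by (simp add: twig_arcs_def star_arcs_def)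
qed

text \<open>
  The vertices of \<open>B\<close> get their twig labels \<open>f\<close> from \<open>P\<close>. Once these are known, all labels at a
  vertex of \<open>A\<close> except that of its star arc are known, and the labels \<open>S\<close> of the star arcs are
  distributed by sorting. The order of the small labels is a parameter: the list \<open>pre\<close> contains
  arcs that need the smallest labels, and \<open>post\<close> arcs that may get labels above the inner arcs.
\<close>
theorem layered_labelling:
  fixes f :: "'a \<Rightarrow> nat"
  assumes hs: "inner_list hs" and cs: "outer_list (pre @ post)"
    and L: "L = length (pre @ hs @ post)"
    and PS: "P \<inter> S = {}" "P \<union> S = {Suc L..L + card A + card B}"
    and f: "bij_betw f B P" "inj_on (\<lambda>b. list_sum (length pre) hs b + int (f b)) B"
  shows "\<exists>\<tau>. bij_betw \<tau> (all_arcs (pre @ hs @ post)) {1..L + card A + card B} \<and>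
    map \<tau> (pre @ hs @ post) = [1..<Suc L] \<and> bij_betw (\<lambda>a. \<tau> (a, \<sigma> a)) A S \<and>
    inj_on (net (all_arcs (pre @ hs @ post)) \<tau>) (A \<union> B) \<and>
    (\<forall>a\<in>A. net (all_arcs (pre @ hs @ post)) \<tau> a < 0) \<and>
    (\<forall>b\<in>B. net (all_arcs (pre @ hs @ post)) \<tau> b = list_sum (length pre) hs b + int (f b))"
proof -
  let ?L = "pre @ hs @ post" and ?D = "all_arcs (pre @ hs @ post)"
  note d = all_arcs_disjoint[OF hs cs]
  have finPS: "finite P" "finite S" using PS(2) by (metis finite_Un finite_atLeastAtMost)+
  have "card P = card B" using f(1) by (metis bij_betw_same_card)
  moreover have "card P + card S = card A + card B"
    using PS card_Un_disjoint[OF finPS PS(1)] by simp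
  ultimately have cS: "card A = card S" by simp
  \<comment> \<open>the sums at \<open>A\<close> without the star arcs, which are outgoing; hence \<open>- w\<close> is to be sorted\<close>
  define w where "w = (\<lambda>a. list_sum 0 ?L a - (\<Sum>b | b \<in> B \<and> \<pi> b = a. int (f b)))"
  obtain g where g: "bij_betw g A S" "inj_on (\<lambda>a. - w a + int (g a)) A"
    using sorted_assignment[of A S "\<lambda>a. - w a"] cS finPS finite_parts by auto
  obtain t where t: "map t ?L = [1..<Suc L]"
    using relabel_list[OF d(1), of "[1..<Suc L]"] L by (auto simp del: upt_Suc map_append)
  define \<tau> where "\<tau> = (\<lambda>e. if e \<in> star_arcs then g (fst e) else if e \<in> twig_arcs then f (snd e) else t e)"
  have \<tau>s: "\<tau> (a, \<sigma> a) = g a" if "a \<in> A" for a using that by (auto simp: \<tau>_def star_arcs_def)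
  have \<tau>t: "\<tau> (\<pi> b, b) = f b" if "b \<in> B" for b
  proof -
    have "(\<pi> b, b) \<in> twig_arcs" using that by (auto simp: twig_arcs_def)
    then show ?thesis using d(3) by (auto simp: \<tau>_def)
  qed
  have \<tau>l: "map \<tau> ?L = [1..<Suc L]"
    unfolding t[symmetric] using d by (intro map_cong refl) (auto simp: \<tau>_def)
  have bl: "bij_betw \<tau> (set ?L) {1..L}"
  proof -
    have "distinct (map \<tau> ?L)" "set (map \<tau> ?L) = {1..L}" unfolding \<tau>l by auto
    then show ?thesis unfolding bij_betw_def distinct_map by auto
  qed
  have bt: "bij_betw \<tau> twig_arcs P"
  proof -
    have "bij_betw (\<lambda>b. \<tau> (\<pi> b, b)) B P" by (subst bij_betw_cong[of _ _ f]) (use f(1) \<tau>t in auto)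
    then show ?thesis unfolding twig_arcs_def bij_betw_def by (auto simp: inj_on_def image_image)
  qed
  have bs': "bij_betw (\<lambda>a. \<tau> (a, \<sigma> a)) A S" by (subst bij_betw_cong[of _ _ g]) (use g(1) \<tau>s in auto)
  then have bs: "bij_betw \<tau> star_arcs S"
    unfolding star_arcs_def bij_betw_def by (auto simp: inj_on_def image_image)
  have PL: "{1..L} \<inter> P = {}" "({1..L} \<union> P) \<inter> S = {}" 
  proof -
    have sub: "P \<union> S \<subseteq> {Suc L..}" unfolding PS(2) by auto
    then show "{1..L} \<inter> P = {}" by fastforce
    have "{1..L} \<inter> S = {}" using sub by fastforce
    then show "({1..L} \<union> P) \<inter> S = {}" using PS(1) by blast
  qed
  have "bij_betw \<tau> ?D (({1..L} \<union> P) \<union> S)"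
    unfolding all_arcs_def by (rule bij_betw_combine[OF bij_betw_combine[OF bl bt PL(1)] bs PL(2)])
  moreover have "({1..L} \<union> P) \<union> S = {1..L + card A + card B}" unfolding Un_assoc PS(2) by auto
  ultimately have bij: "bij_betw \<tau> ?D {1..L + card A + card B}" by simp
  note net = net_all_arcs[OF hs cs \<tau>l[unfolded L]]
  have csn: "fst e \<in> A \<union> X \<and> snd e \<in> X" if "e \<in> set pre \<union> set post" for e
    using that cs by (auto simp: outer_list_def)
  have netB: "net ?D \<tau> b = list_sum (length pre) hs b + int (f b)" if b: "b \<in> B" for b
  proof -
    have z: "list_sum c pre b = 0" "list_sum c post b = 0" for c
      by (rule list_sum_zero, use csn b disj in blast)+
    have "b \<notin> A" "\<And>b'. b' \<in> B \<Longrightarrow> \<pi> b' \<noteq> b" "\<And>a. a \<in> A \<Longrightarrow> \<sigma> a \<noteq> b"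
      using b disj star twig by blast+
    then have e: "{b'. b' \<in> B \<and> \<pi> b' = b} = {}" "{a. a \<in> A \<and> \<sigma> a = b} = {}" "b \<notin> A" by auto
    show ?thesis using net[of b] b \<tau>t[OF b] e(3) unfolding e(1,2) sum.empty
      by (simp add: list_sum_append z)
  qed
  have netA: "net ?D \<tau> a = w a - int (g a)" if a: "a \<in> A" for a
  proof -
    have e: "a \<notin> B" "{a'. a' \<in> A \<and> \<sigma> a' = a} = {}" using a disj star by blast+
    have "(\<Sum>b | b \<in> B \<and> \<pi> b = a. int (\<tau> (\<pi> b, b))) = (\<Sum>b | b \<in> B \<and> \<pi> b = a. int (f b))"
      using \<tau>t by (intro sum.cong) auto
    then show ?thesis using net[of a] a \<tau>s[OF a] e(1) unfolding e(2) sum.empty by (simp add: w_def)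
  qed
  have neg: "net ?D \<tau> a < 0" if a: "a \<in> A" for a
  proof -
    have "list_sum c pre a \<le> 0" "list_sum c post a \<le> 0" for c
      by (rule list_sum_nonpos, use csn a disj in blast)+
    moreover have "list_sum (length pre) hs a \<le> int (length pre + length hs)"
      using hs a by (auto simp: inner_list_def)
    ultimately have "list_sum 0 ?L a \<le> int L" by (smt (verit) L add_0 int_plus length_append list_sum_append of_nat_0_le_iff)
    moreover have "g a \<in> S" using g(1) a by (auto simp: bij_betw_def)
    then have "L < g a" using PS(2) by (metis Suc_le_eq UnI2 atLeastAtMost_iff)
    moreover have "0 \<le> (\<Sum>b | b \<in> B \<and> \<pi> b = a. int (f b))" by (simp add: sum_nonneg)
    ultimately show ?thesis by (simp add: netA[OF a] w_def)
  qed
  have pos: "0 < net ?D \<tau> b" if b: "b \<in> B" for b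
  proof -
    have "b \<notin> A" using b disj by auto
    then have "- int (length pre + length hs) \<le> list_sum (length pre) hs b" using hs by (auto simp: inner_list_def)
    moreover have "f b \<in> P" using f(1) b by (auto simp: bij_betw_def)
    then have "L < f b" using PS(2) by (metis Suc_le_eq UnI1 atLeastAtMost_iff)
    ultimately show ?thesis using netB[OF b] L by simp
  qed
  have "inj_on (net ?D \<tau>) A"
  proof (rule inj_onI)
    fix a a' assume "a \<in> A" "a' \<in> A" "net ?D \<tau> a = net ?D \<tau> a'"
    then have "- w a + int (g a) = - w a' + int (g a')" using netA by simp
    then show "a = a'" using inj_onD[OF g(2)] \<open>a \<in> A\<close> \<open>a' \<in> A\<close> by blast
  qed
  moreover have "inj_on (net ?D \<tau>) B"
    by (subst inj_on_cong[of _ _ "\<lambda>b. list_sum (length pre) hs b + int (f b)"]) (use f(2) netB in auto)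
  moreover have "net ?D \<tau> ` A \<inter> net ?D \<tau> ` B = {}" using neg pos by fastforce
  ultimately have "inj_on (net ?D \<tau>) (A \<union> B)" by (auto simp: inj_on_Un)
  then show ?thesis using bij \<tau>l bs' neg netB by blast
qed

section \<open>One centre\<close>

text \<open>
  The sum at the centre is the sum of the set \<open>S\<close> of star labels and does not depend on how \<open>S\<close> is
  distributed. This breaks the circularity that would arise from sorting \<open>x\<close> together with \<open>B\<close>
  before the labels of the star arcs are assigned.
\<close>
lemma single_centre:
  assumes X: "X = {x}" and ne: "A \<noteq> {}"
  shows "\<exists>D \<tau>. antimagic_orientation G (D, \<tau>)"
proof -
  obtain hs where hs: "inner_list hs" using inner_list_exists by blast
  have cs: "outer_list ([] @ [])"
  proof -
    have "\<sigma> a = x" if "a \<in> A" for a using star[OF that] X by auto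
    then have "y = \<sigma> a" if "a \<in> A" "y \<in> X" for a y using that X by simp
    moreover have "(y, z) \<notin> parcs G" if "y \<in> X" "z \<in> X" for y z
      using pair_no_loops[of "(y, z)"] that X by auto
    ultimately show ?thesis unfolding outer_list_def by simp
  qed
  define L where "L = length hs"
  define m where "m = L + card A + card B"
  \<comment> \<open>the \<open>card A - 1\<close> labels that are certain to be star labels\<close>
  define top where "top = {L + card B + 2..m}"
  define w where "w = (\<lambda>v. if v = x then (\<Sum>t\<in>top. int t) else list_sum 0 hs v)"
  have xB: "x \<notin> B" "x \<notin> A" using X disj by auto
  obtain h where h: "bij_betw h (insert x B) {Suc L..Suc (L + card B)}"
      "inj_on (\<lambda>v. w v + int (h v)) (insert x B)"
  proof -
    have "card (insert x B) = card {Suc L..Suc (L + card B)}" using xB finite_parts(2) by simp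
    then show ?thesis using sorted_assignment[of "insert x B" "{Suc L..Suc (L + card B)}" w] finite_parts(2) that
      by blast
  qed
  define P where "P = h ` B"
  define S where "S = insert (h x) top"
  have hb: "h x \<notin> P" "insert (h x) P = {Suc L..Suc (L + card B)}" "inj_on h B"
    using h(1) xB by (auto simp: bij_betw_def P_def inj_on_def)
  have "1 \<le> card A" using ne finite_parts by (simp add: Suc_le_eq card_gt_0_iff)
  then have union: "{Suc L..Suc (L + card B)} \<union> top = {Suc L..L + card A + card B}"
    by (auto simp: top_def m_def)
  have "{Suc L..Suc (L + card B)} \<inter> top = {}" by (auto simp: top_def)
  then have PS: "P \<inter> S = {}" "P \<union> S = {Suc L..L + card A + card B}" "h x \<notin> top"
    using hb(1,2) union unfolding S_def by blast+
  have f: "bij_betw h B P" using hb(3) by (simp add: P_def bij_betw_def)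
  have "inj_on (\<lambda>b. list_sum (length ([] :: ('a \<times> 'a) list)) hs b + int (h b)) B"
    by (rule inj_onI, rule inj_onD[OF h(2)]) (use xB in \<open>auto simp: w_def\<close>)
  from layered_labelling[OF hs cs _ PS(1,2) f this] obtain \<tau> where
    \<tau>: "bij_betw \<tau> (all_arcs ([] @ hs @ [])) {1..L + card A + card B}"
    "map \<tau> ([] @ hs @ []) = [1..<Suc L]" "bij_betw (\<lambda>a. \<tau> (a, \<sigma> a)) A S"
    "inj_on (net (all_arcs ([] @ hs @ [])) \<tau>) (A \<union> B)"
    "\<And>a. a \<in> A \<Longrightarrow> net (all_arcs ([] @ hs @ [])) \<tau> a < 0"
    "\<And>b. b \<in> B \<Longrightarrow> net (all_arcs ([] @ hs @ [])) \<tau> b = list_sum 0 hs b + int (h b)"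
    by (auto simp: L_def)
  let ?D = "all_arcs ([] @ hs @ [])"
  \<comment> \<open>\<open>h x\<close>, chosen as the private label of \<open>x\<close>, is a label of some star arc, and all star arcs enter \<open>x\<close>\<close>
  have netx: "net ?D \<tau> x = w x + int (h x)"
  proof -
    have "set hs \<subseteq> inner_arcs" using hs by (simp add: inner_list_def)
    then have z: "list_sum 0 hs x = 0" using xB by (intro list_sum_zero) (auto simp: inner_arcs_def)
    have e: "{b. b \<in> B \<and> \<pi> b = x} = {}" "{a. a \<in> A \<and> \<sigma> a = x} = A" using twig star X xB by auto
    have "net ?D \<tau> x = (\<Sum>a\<in>A. int (\<tau> (a, \<sigma> a)))"
      using net_all_arcs[OF hs cs, of \<tau> x] \<tau>(2) xB z unfolding e by (simp add: L_def)
    also have "\<dots> = (\<Sum>s\<in>S. int s)" by (rule sum.reindex_bij_betw[OF \<tau>(3)])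
    also have "\<dots> = w x + int (h x)" using PS(3) by (simp add: S_def w_def top_def)
    finally show ?thesis .
  qed
  have "net ?D \<tau> x \<noteq> net ?D \<tau> b" if b: "b \<in> B" for b
  proof
    assume "net ?D \<tau> x = net ?D \<tau> b"
    then have "w x + int (h x) = w b + int (h b)" using netx \<tau>(6)[OF b] b xB by (auto simp: w_def)
    then have "x = b" using inj_onD[OF h(2)] b by blast
    then show False using b xB by simp
  qed
  moreover have "net ?D \<tau> x \<noteq> net ?D \<tau> a" if "a \<in> A" for a
  proof -
    have "0 \<le> w x" by (simp add: w_def sum_nonneg)
    then show ?thesis using \<tau>(5)[OF that] netx by simp
  qed
  ultimately have "inj_on (net ?D \<tau>) (insert x (A \<union> B))"
    using \<tau>(4) by (auto simp: inj_on_insert)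
  moreover have "pverts G = insert x (A \<union> B)" using verts X by auto
  ultimately show ?thesis using antimagicI[OF all_arcs_orientation[OF hs cs] \<tau>(1)] by simp
qed

section \<open>Several centres with private neighbours\<close>

text \<open>
  The invariant of the moves that separate the centres. A label counts as large if it is at least
  \<open>M\<close>; \<open>Y x\<close> is a set of three vertices of \<open>A\<close> whose arcs to the centre \<open>x\<close> are large and remain
  untouched, and \<open>nx x\<close> is the only possible out-neighbour of \<open>x\<close>. By \<open>net_lower_bound\<close>, all sums
  on \<open>X\<close> are then at least \<open>3 * M - 4\<close>, above all the other sums.
\<close>
definition centred :: "('a \<times> 'a) set \<Rightarrow> nat \<Rightarrow> nat \<Rightarrow> ('a \<Rightarrow> 'a set) \<Rightarrow> ('a \<Rightarrow> 'a) \<Rightarrow> ('a \<times> 'a \<Rightarrow> nat) \<Rightarrow> bool" where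
  "centred D m M Y nx \<tau> \<longleftrightarrow>
     is_orientation G \<lparr>pverts = pverts G, parcs = D\<rparr> \<and> bij_betw \<tau> D {1..m} \<and>
     inj_on (net D \<tau>) (A \<union> B) \<and> (\<forall>v\<in>A \<union> B. net D \<tau> v < 3 * int M - 4) \<and>
     (\<forall>x\<in>X. {e \<in> D. fst e = x} \<subseteq> {(x, nx x)} \<and> ((x, nx x) \<in> D \<longrightarrow> \<tau> (x, nx x) \<le> 4) \<and>
        Y x \<subseteq> A \<and> card (Y x) = 3 \<and> (\<forall>y\<in>Y x. (y, x) \<in> D \<and> M \<le> \<tau> (y, x)))"

lemma centred_finite: "centred D m M Y nx \<tau> \<Longrightarrow> finite D"
  using pair_finite_arcs by (auto simp: centred_def is_orientation_def intro: finite_subset)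

lemma centred_antimagic:
  assumes c: "centred D m M Y nx \<tau>" and inj: "inj_on (net D \<tau>) X"
  shows "\<exists>D \<tau>. antimagic_orientation G (D, \<tau>)"
proof -
  have "3 * int M - 4 \<le> net D \<tau> x" if "x \<in> X" for x
    using net_lower_bound[of D "Y x" x M \<tau> "nx x" 4] c that centred_finite[OF c] by (simp add: centred_def)
  moreover have "\<And>v. v \<in> A \<union> B \<Longrightarrow> net D \<tau> v < 3 * int M - 4" "inj_on (net D \<tau>) (A \<union> B)"
    using c by (auto simp: centred_def)
  ultimately have "inj_on (net D \<tau>) (A \<union> B \<union> X)"
    using inj by (force simp: inj_on_Un)
  then show ?thesis using antimagicI[of G D \<tau> m] c verts by (simp add: centred_def)
qed

lemma centred_redistribute:
  assumes c: "centred D m M Y nx \<tau>" and y: "y \<in> A" and Z: "Z \<subseteq> X"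
    and a: "\<And>z. z \<in> Z \<Longrightarrow> (y, z) \<in> D \<and> y \<notin> Y z"
    and f: "bij_betw f Z ((\<lambda>z. \<tau> (y, z)) ` Z)"
  obtains \<tau>' where "centred D m M Y nx \<tau>'"
    "\<And>z. z \<in> Z \<Longrightarrow> net D \<tau>' z = net D \<tau> z - int (\<tau> (y, z)) + int (f z)"
    "\<And>u. u \<notin> Z \<Longrightarrow> net D \<tau>' u = net D \<tau> u" "\<And>e. fst e \<noteq> y \<Longrightarrow> \<tau>' e = \<tau> e"
proof -
  define \<tau>' where "\<tau>' = (\<lambda>e. if fst e = y \<and> snd e \<in> Z then f (snd e) else \<tau> e)"
  have yZ: "y \<notin> Z" "y \<notin> X" using y Z disj by auto
  have bij: "bij_betw \<tau> D {1..m}" using c by (simp add: centred_def)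
  note r = redistribute_out_labels[OF centred_finite[OF c] _ yZ(1) bij f, folded \<tau>'_def]
  have r2: "\<And>z. z \<in> Z \<Longrightarrow> net D \<tau>' z = net D \<tau> z - int (\<tau> (y, z)) + int (f z)"
    and r3: "\<And>u. u \<notin> Z \<Longrightarrow> net D \<tau>' u = net D \<tau> u" and r1: "bij_betw \<tau>' D {1..m}"
    using r a by auto
  have ZAB: "v \<notin> Z" if "v \<in> A \<union> B" for v using that Z disj by auto
  have "inj_on (net D \<tau>') (A \<union> B)"
    by (subst inj_on_cong[of _ _ "net D \<tau>"]) (use r3 ZAB c in \<open>auto simp: centred_def\<close>)
  moreover have "net D \<tau>' v < 3 * int M - 4" if "v \<in> A \<union> B" for v
    using r3[OF ZAB[OF that]] c that by (simp add: centred_def)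
  moreover have "\<tau>' (z, v) = \<tau> (z, v)" if "z \<in> Y v \<or> z \<in> X" for z v
    using that a[of v] yZ(2) by (auto simp: \<tau>'_def)
  ultimately have "centred D m M Y nx \<tau>'" using c r1 by (simp add: centred_def)
  then show ?thesis using that r2 r3 by (auto simp: \<tau>'_def)
qed

lemma centred_swap:
  assumes c: "centred D m M Y nx \<tau>" and y: "y \<in> A" and pq: "p \<in> X" "q \<in> X" "p \<noteq> q"
    and a: "(y, p) \<in> D" "(y, q) \<in> D" "y \<notin> Y p" "y \<notin> Y q"
  obtains \<tau>' where "centred D m M Y nx \<tau>'"
    "net D \<tau>' p = net D \<tau> p - int (\<tau> (y, p)) + int (\<tau> (y, q))"
    "net D \<tau>' q = net D \<tau> q - int (\<tau> (y, q)) + int (\<tau> (y, p))"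
    "\<And>u. u \<noteq> p \<Longrightarrow> u \<noteq> q \<Longrightarrow> net D \<tau>' u = net D \<tau> u" "\<And>e. fst e \<noteq> y \<Longrightarrow> \<tau>' e = \<tau> e"
proof -
  define f where "f = (\<lambda>z. if z = p then \<tau> (y, q) else \<tau> (y, p))"
  have "inj_on \<tau> D" using c by (simp add: centred_def bij_betw_def)
  then have "\<tau> (y, p) \<noteq> \<tau> (y, q)" using a pq by (metis inj_onD prod.inject)
  then have "bij_betw f {p, q} ((\<lambda>z. \<tau> (y, z)) ` {p, q})"
    using pq(3) by (auto simp: bij_betw_def f_def)
  then obtain \<tau>' where \<tau>': "centred D m M Y nx \<tau>'"
    "\<And>z. z \<in> {p, q} \<Longrightarrow> net D \<tau>' z = net D \<tau> z - int (\<tau> (y, z)) + int (f z)"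
    "\<And>u. u \<notin> {p, q} \<Longrightarrow> net D \<tau>' u = net D \<tau> u" "\<And>e. fst e \<noteq> y \<Longrightarrow> \<tau>' e = \<tau> e"
    using centred_redistribute[OF c y, of "{p, q}" f] a pq by auto
  show ?thesis using that[OF \<tau>'(1)] \<tau>'(2)[of p] \<tau>'(2)[of q] \<tau>'(3,4) pq(3) by (simp add: f_def)
qed

lemma centred_common_neighbour:
  assumes c: "centred D m M Y nx \<tau>" and y: "y \<in> A"
    and a: "\<And>x. x \<in> X \<Longrightarrow> (y, x) \<in> D \<and> y \<notin> Y x"
  shows "\<exists>D \<tau>. antimagic_orientation G (D, \<tau>)"
proof -
  let ?T = "(\<lambda>z. \<tau> (y, z)) ` X"
  have "inj_on \<tau> D" using c by (simp add: centred_def bij_betw_def)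
  then have "inj_on (\<lambda>z. \<tau> (y, z)) X" using a by (auto simp: inj_on_def)
  then have "card X = card ?T" by (simp add: card_image)
  then obtain f where f: "bij_betw f X ?T" "inj_on (\<lambda>x. (net D \<tau> x - int (\<tau> (y, x))) + int (f x)) X"
    using sorted_assignment[of X ?T "\<lambda>x. net D \<tau> x - int (\<tau> (y, x))"] finite_parts by auto
  obtain \<tau>' where \<tau>': "centred D m M Y nx \<tau>'"
    "\<And>z. z \<in> X \<Longrightarrow> net D \<tau>' z = net D \<tau> z - int (\<tau> (y, z)) + int (f z)"
    using centred_redistribute[OF c y subset_refl a f(1)] by metis
  have "inj_on (net D \<tau>') X"
    by (subst inj_on_cong[OF \<tau>'(2)]) (use f(2) in auto)
  then show ?thesis by (rule centred_antimagic[OF \<tau>'(1)])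
qed

text \<open>
  Swapping the labels of the two arcs at \<open>y\<close> moves an amount \<open>d\<close> from \<open>x1\<close> to \<open>x2\<close>, and swapping at
  \<open>y'\<close> moves \<open>e\<close> from \<open>x3\<close> to \<open>x2\<close>. For \<open>0 < e < d\<close> at least one of the four combinations makes the
  sums at the three centres distinct. For \<open>d = e\<close> this would fail if \<open>x1\<close> and \<open>x3\<close> had
  the same sum and the sum at \<open>x2\<close> were smaller by \<open>d\<close> or \<open>2 * d\<close>.
\<close>
lemma centred_chain:
  assumes c: "centred D m M Y nx \<tau>" and X: "X = {x1, x2, x3}" "distinct [x1, x2, x3]"
    and y: "y \<in> A" "y' \<in> A" "y \<noteq> y'"
    and a: "(y, x1) \<in> D" "(y, x2) \<in> D" "(y', x2) \<in> D" "(y', x3) \<in> D"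
    and nY: "\<And>x. x \<in> X \<Longrightarrow> y \<notin> Y x \<and> y' \<notin> Y x"
    and gap: "\<tau> (y', x2) < \<tau> (y', x3)"
      "int (\<tau> (y', x3)) - int (\<tau> (y', x2)) < int (\<tau> (y, x1)) - int (\<tau> (y, x2))"
  shows "\<exists>D \<tau>. antimagic_orientation G (D, \<tau>)"
proof -
  define d e where "d = int (\<tau> (y, x1)) - int (\<tau> (y, x2))" and "e = int (\<tau> (y', x3)) - int (\<tau> (y', x2))"
  have de: "0 < e" "e < d" using gap by (auto simp: d_def e_def)
  have xs: "x1 \<in> X" "x2 \<in> X" "x3 \<in> X" "x1 \<noteq> x2" "x3 \<noteq> x2" "x3 \<noteq> x1" using X by auto
  have nYs: "y \<notin> Y x1" "y \<notin> Y x2" "y' \<notin> Y x2" "y' \<notin> Y x3" using nY xs by auto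
  obtain \<tau>1 where s1: "centred D m M Y nx \<tau>1"
      "net D \<tau>1 x1 = net D \<tau> x1 - int (\<tau> (y, x1)) + int (\<tau> (y, x2))"
      "net D \<tau>1 x2 = net D \<tau> x2 - int (\<tau> (y, x2)) + int (\<tau> (y, x1))"
      "\<And>u. u \<noteq> x1 \<Longrightarrow> u \<noteq> x2 \<Longrightarrow> net D \<tau>1 u = net D \<tau> u" "\<And>e. fst e \<noteq> y \<Longrightarrow> \<tau>1 e = \<tau> e"
    using centred_swap[OF c y(1) xs(1,2,4) a(1,2) nYs(1,2)] by metis
  have t1: "net D \<tau>1 x1 = net D \<tau> x1 - d" "net D \<tau>1 x2 = net D \<tau> x2 + d" "net D \<tau>1 x3 = net D \<tau> x3"
    using s1(2,3) s1(4)[OF xs(6,5)] by (simp_all add: d_def)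
  obtain \<tau>2 where s2: "centred D m M Y nx \<tau>2"
      "net D \<tau>2 x3 = net D \<tau> x3 - int (\<tau> (y', x3)) + int (\<tau> (y', x2))"
      "net D \<tau>2 x2 = net D \<tau> x2 - int (\<tau> (y', x2)) + int (\<tau> (y', x3))"
      "\<And>u. u \<noteq> x3 \<Longrightarrow> u \<noteq> x2 \<Longrightarrow> net D \<tau>2 u = net D \<tau> u"
    using centred_swap[OF c y(2) xs(3,2,5) a(4,3) nYs(4,3)] by metis
  have t2: "net D \<tau>2 x1 = net D \<tau> x1" "net D \<tau>2 x2 = net D \<tau> x2 + e" "net D \<tau>2 x3 = net D \<tau> x3 - e"
    using s2(2,3) s2(4)[OF xs(6)[symmetric] xs(4)] by (simp_all add: e_def)
  have keep: "\<tau>1 (y', x) = \<tau> (y', x)" for x using s1(5)[of "(y', x)"] y(3) by simp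
  obtain \<tau>3 where s3: "centred D m M Y nx \<tau>3"
      "net D \<tau>3 x3 = net D \<tau>1 x3 - int (\<tau>1 (y', x3)) + int (\<tau>1 (y', x2))"
      "net D \<tau>3 x2 = net D \<tau>1 x2 - int (\<tau>1 (y', x2)) + int (\<tau>1 (y', x3))"
      "\<And>u. u \<noteq> x3 \<Longrightarrow> u \<noteq> x2 \<Longrightarrow> net D \<tau>3 u = net D \<tau>1 u"
    using centred_swap[OF s1(1) y(2) xs(3,2,5) a(4,3) nYs(4,3)] by metis
  have t3: "net D \<tau>3 x1 = net D \<tau> x1 - d" "net D \<tau>3 x2 = net D \<tau> x2 + d + e" "net D \<tau>3 x3 = net D \<tau> x3 - e"
    using s3(2,3) s3(4)[OF xs(6)[symmetric] xs(4)] t1 keep by (simp_all add: e_def)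
  define g where "g = (\<lambda>\<tau>. net D \<tau> x1 \<noteq> net D \<tau> x2 \<and> net D \<tau> x2 \<noteq> net D \<tau> x3 \<and> net D \<tau> x1 \<noteq> net D \<tau> x3)"
  have "g \<tau> \<or> g \<tau>1 \<or> g \<tau>2 \<or> g \<tau>3"
    unfolding g_def t1 t2 t3 using de by linarith
  moreover have "inj_on (net D \<rho>) X" if "g \<rho>" for \<rho>
    using that X by (auto simp: g_def)
  ultimately show ?thesis using centred_antimagic c s1(1) s2(1) s3(1) by blast
qed

text \<open>
  If the two centres have equal sums, reversing the edge between them raises one sum and lowers the
  other. As \<open>x2\<close> has no outgoing arc and the edge has label at most 2, its sum stays large enough.
\<close>
lemma centred_edge:
  assumes c: "centred D m M Y nx \<tau>" and X: "X = {x1, x2}" "x1 \<noteq> x2"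
    and a: "(x1, x2) \<in> D" "\<tau> (x1, x2) \<le> 2" "{e \<in> D. fst e = x2} = {}"
  shows "\<exists>D \<tau>. antimagic_orientation G (D, \<tau>)"
proof (cases "net D \<tau> x1 = net D \<tau> x2")
  case False
  then have "inj_on (net D \<tau>) X" using X by auto
  then show ?thesis by (rule centred_antimagic[OF c])
next
  case True
  have fin: "finite D" by (rule centred_finite[OF c])
  let ?E = "D - {(x1, x2)}"
  let ?D = "insert (x2, x1) ?E"
  define l where "l = \<tau> (x1, x2)"
  define \<tau>' where "\<tau>' = \<tau>((x2, x1) := l)"
  have bij: "bij_betw \<tau> D {1..m}" using c by (simp add: centred_def)
  then have l: "1 \<le> l" "l \<le> 2" using a by (auto simp: bij_betw_def l_def)
  have n: "(x2, x1) \<notin> ?E" using a(3) by auto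
  have out: "\<tau>' e = \<tau> e" if "e \<in> ?E" for e using that n by (auto simp: \<tau>'_def)
  have D: "{(x1, x2)} \<union> ?E = D" using a(1) by auto
  have n1: "net D \<tau> u = int l * signed_inc u (x1, x2) + net ?E \<tau> u" for u
    using net_union[of "{(x1, x2)}" ?E \<tau> u] fin unfolding D by (simp add: net_single l_def)
  have n2: "net ?D \<tau>' u = int l * signed_inc u (x2, x1) + net ?E \<tau> u" for u
  proof -
    have "net ?E \<tau>' u = net ?E \<tau> u" by (rule net_cong) (rule out)
    moreover have "{(x2, x1)} \<union> ?E = ?D" "\<tau>' (x2, x1) = l" by (auto simp: \<tau>'_def)
    ultimately show ?thesis
      using net_union[of "{(x2, x1)}" ?E \<tau>' u] fin n by (simp add: net_single)
  qed
  have "signed_inc u (x1, x2) = - signed_inc u (x2, x1)" for u by (simp add: signed_inc_def)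
  then have net: "net ?D \<tau>' u = net D \<tau> u + 2 * int l * signed_inc u (x2, x1)" for u
    using n1[of u] n2[of u] by (simp add: algebra_simps)
  have x: "net ?D \<tau>' x1 = net D \<tau> x1 + 2 * int l" "net ?D \<tau>' x2 = net D \<tau> x2 - 2 * int l"
    using X(2) by (simp_all add: net signed_inc_def)
  have rest: "net ?D \<tau>' u = net D \<tau> u" if "u \<in> A \<union> B" for u
    using that X disj by (auto simp: net signed_inc_def)
  have "3 * int M - int 0 \<le> net D \<tau> x2"
  proof -
    have "x2 \<in> X" using X by simp
    then have "card (Y x2) = 3" "\<And>y. y \<in> Y x2 \<Longrightarrow> (y, x2) \<in> D \<and> M \<le> \<tau> (y, x2)"
      using c by (simp_all add: centred_def)
    moreover have "(x2, nx x2) \<notin> D" using a(3) by auto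
    ultimately show ?thesis using net_lower_bound[OF fin, of "Y x2" x2 M \<tau> "nx x2" 0] a(3) by simp
  qed
  then have big: "3 * int M - 4 \<le> net ?D \<tau>' x" if "x \<in> X" for x
    using that x True l X by auto
  have "inj_on (net ?D \<tau>') (A \<union> B)"
    by (subst inj_on_cong[OF rest]) (use c in \<open>auto simp: centred_def\<close>)
  moreover have "inj_on (net ?D \<tau>') X" using X x True l by auto
  moreover have "\<And>v. v \<in> A \<union> B \<Longrightarrow> net ?D \<tau>' v < 3 * int M - 4"
    using rest c by (simp add: centred_def)
  ultimately have "inj_on (net ?D \<tau>') (pverts G)"
    unfolding verts using big by (force simp: inj_on_Un)
  moreover have "bij_betw \<tau>' ?D {1..m}"
  proof -
    have "bij_betw \<tau> ?E (\<tau> ` ?E)" using bij by (auto simp: bij_betw_def inj_on_def)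
    then have "bij_betw \<tau>' ?E (\<tau> ` ?E)" by (subst bij_betw_cong[OF out]) auto
    moreover have "l \<notin> \<tau> ` ?E" using bij a(1) by (auto simp: bij_betw_def inj_on_def l_def)
    ultimately have "bij_betw \<tau>' (?E \<union> {(x2, x1)}) (\<tau> ` ?E \<union> {l})"
      using notIn_Un_bij_betw[OF n, of \<tau>' "\<tau> ` ?E"] by (simp add: \<tau>'_def)
    moreover have "\<tau> ` ?E \<union> {l} = {1..m}" using bij a(1) by (auto simp: bij_betw_def l_def)
    ultimately show ?thesis by simp
  qed
  moreover have "is_orientation G \<lparr>pverts = pverts G, parcs = ?D\<rparr>"
  proof -
    have o: "D \<subseteq> parcs G" "\<And>u v. (u, v) \<in> parcs G \<Longrightarrow> (u, v) \<in> D \<longleftrightarrow> (v, u) \<notin> D"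
      using c by (auto simp: centred_def is_orientation_def)
    have "(x2, x1) \<in> parcs G" using a(1) o(1) by (auto intro: arc_sym)
    then show ?thesis using o X(2) n a(1) by (auto simp: is_orientation_def)
  qed
  ultimately show ?thesis using antimagicI by blast
qed

lemma card_verts: "card (pverts G) = card A + card B + card X"
  unfolding verts using finite_parts disj by (simp add: card_Un_disjoint Int_Un_distrib2)

text \<open>
  The arcs of \<open>s1\<close> get the first labels and those of \<open>s2\<close> the last ones below the twigs and star
  arcs. The arcs between centres follow directly after \<open>s1\<close>, so that they diminish the sums on \<open>X\<close>
  by at most 4. The condition \<open>size\<close> says that there are at least \<open>card A + card B - 2\<close> labels below
  those of the twigs and star arcs; this outweighs the number of passages of trails at a vertex
  of \<open>B\<close>.
\<close>
lemma many_centres: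
  assumes size: "2 * card (pverts G) \<le> card (edges G) + 2 * card X + 2"
    and A3: "3 \<le> card A"
    and nx: "\<And>x y. x \<in> X \<Longrightarrow> y \<in> X \<Longrightarrow> (x, y) \<in> parcs G \<Longrightarrow> y = nx x \<longleftrightarrow> x \<noteq> nx y"
    and cX: "length s1 + card X \<le> 4"
    and s: "distinct (s1 @ s2)" "\<And>e. e \<in> set (s1 @ s2) \<Longrightarrow> fst e \<in> A \<and> snd e \<in> X \<and> e \<in> parcs G \<and> snd e \<noteq> \<sigma> (fst e)"
    and Y: "\<And>x. x \<in> X \<Longrightarrow> card (Y x) = 3 \<and> (\<forall>y\<in>Y x. y \<in> A \<and> \<sigma> y = x)"
  obtains D m M \<tau> L where "centred D m M Y nx \<tau>" "M = L + card B + 1"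
    "card (edges G) = L + card A + card B"
    "\<And>a. a \<in> A \<Longrightarrow> M \<le> \<tau> (a, \<sigma> a) \<and> \<tau> (a, \<sigma> a) < M + card A"
    "\<And>e. s1 = [e] \<Longrightarrow> \<tau> e = 1" "\<And>e. s2 = [e] \<Longrightarrow> \<tau> e = L"
    "\<And>x. x \<in> X \<Longrightarrow> (x, nx x) \<in> D \<Longrightarrow> \<tau> (x, nx x) \<le> length s1 + card X"
    "\<And>a x. a \<in> A \<Longrightarrow> x \<in> X \<Longrightarrow> (a, x) \<in> parcs G \<Longrightarrow> (a, x) \<in> D"
    "\<And>x. x \<in> X \<Longrightarrow> nx x \<in> X \<Longrightarrow> (x, nx x) \<in> parcs G \<Longrightarrow> (x, nx x) \<in> D"
proof -
  \<comment> \<open>\<open>R\<close> consists of the arcs between centres, \<open>Q\<close> of the remaining non-star arcs from \<open>A\<close> to \<open>X\<close>\<close>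
  define R where "R = {(x, nx x) | x. x \<in> X \<and> nx x \<in> X \<and> (x, nx x) \<in> parcs G}"
  define Q where "Q = {(a, x). a \<in> A \<and> x \<in> X \<and> (a, x) \<in> parcs G \<and> x \<noteq> \<sigma> a} - set (s1 @ s2)"
  have "finite Q" by (rule finite_subset[OF _ pair_finite_arcs]) (auto simp: Q_def)
  then obtain qs where qs: "set qs = Q" "distinct qs" using finite_distinct_list by blast
  have Rim: "R \<subseteq> (\<lambda>x. (x, nx x)) ` X" by (auto simp: R_def)
  then have finR: "finite R" "card R \<le> card X"
    using finite_parts(3) by (auto intro: finite_subset surj_card_le)
  then obtain rs where rs: "set rs = R" "distinct rs" using finite_distinct_list by blast
  have lrs: "length rs \<le> card X" using rs finR distinct_card[of rs] by simp
  define pre where "pre = s1 @ rs"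
  define post where "post = qs @ s2"
  have RA: "R \<inter> Q = {}" "R \<inter> set (s1 @ s2) = {}" "Q \<inter> set (s1 @ s2) = {}"
    using disj s(2) by (force simp: R_def Q_def)+
  have cset: "set (pre @ post) = R \<union> Q \<union> set (s1 @ s2)" using rs qs by (auto simp: pre_def post_def)
  have dist: "distinct (pre @ post)" using rs qs s(1) RA by (auto simp: pre_def post_def)
  have star_iff: "(a, x) \<in> star_arcs \<longleftrightarrow> a \<in> A \<and> x = \<sigma> a" for a x by (auto simp: star_arcs_def)
  have out: "e \<in> parcs G \<and> fst e \<in> A \<union> X \<and> snd e \<in> X \<and> e \<notin> star_arcs" if "e \<in> set (pre @ post)" for e
    using that s(2)[of e] disj unfolding cset by (cases e) (auto simp: R_def Q_def star_iff)
  have cAX: "(a, x) \<in> set (pre @ post)" if "a \<in> A" "x \<in> X" "(a, x) \<in> parcs G" "x \<noteq> \<sigma> a" for a x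
    using that unfolding cset by (auto simp: Q_def)
  have cXX: "(x, y) \<in> set (pre @ post) \<longleftrightarrow> y = nx x" if "x \<in> X" "y \<in> X" "(x, y) \<in> parcs G" for x y
  proof -
    have "x \<notin> A" using that disj by auto
    then have "(x, y) \<notin> Q \<union> set (s1 @ s2)" using s(2)[of "(x, y)"] by (auto simp: Q_def)
    then show ?thesis using that unfolding cset by (auto simp: R_def)
  qed
  have cs: "outer_list (pre @ post)"
    unfolding outer_list_def
  proof (intro conjI ballI impI)
    show "distinct (pre @ post)" "set (pre @ post) \<subseteq> parcs G" using dist out by auto
    show "fst e \<in> A \<union> X" "snd e \<in> X" "e \<notin> star_arcs" if "e \<in> set (pre @ post)" for e
      using out[OF that] by auto
    show "(a, x) \<in> set (pre @ post)" if "a \<in> A" "x \<in> X" "(a, x) \<in> parcs G" "x \<noteq> \<sigma> a" for a x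
      using that by (rule cAX)
    show "(x, y) \<in> set (pre @ post) \<longleftrightarrow> (y, x) \<notin> set (pre @ post)" if "x \<in> X" "y \<in> X" "(x, y) \<in> parcs G" for x y
      unfolding cXX[OF that] cXX[OF that(2,1) arc_sym[OF that(3)]] by (rule nx[OF that])
  qed
  obtain hs where hs: "inner_list hs" using inner_list_exists by blast
  define L where "L = length (pre @ hs @ post)"
  define M where "M = L + card B + 1"
  define P where "P = {Suc L..L + card B}"
  define S where "S = {M..L + card A + card B}"
  have PS: "P \<inter> S = {}" "P \<union> S = {Suc L..L + card A + card B}" by (auto simp: P_def S_def M_def)
  obtain f where f: "bij_betw f B P" "inj_on (\<lambda>b. list_sum (length pre) hs b + int (f b)) B"
  proof -
    have "finite P" "card B = card P" by (simp_all add: P_def)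
    then show ?thesis using sorted_assignment[of B P "list_sum (length pre) hs"] finite_parts(2) that by blast
  qed
  let ?D = "all_arcs (pre @ hs @ post)"
  obtain \<tau> where \<tau>: "bij_betw \<tau> ?D {1..L + card A + card B}"
    "map \<tau> (pre @ hs @ post) = [1..<Suc L]" "bij_betw (\<lambda>a. \<tau> (a, \<sigma> a)) A S"
    "inj_on (net ?D \<tau>) (A \<union> B)" "\<And>a. a \<in> A \<Longrightarrow> net ?D \<tau> a < 0"
    "\<And>b. b \<in> B \<Longrightarrow> net ?D \<tau> b = list_sum (length pre) hs b + int (f b)"
    using layered_labelling[OF hs cs L_def PS f] by blast
  have ori: "is_orientation G \<lparr>pverts = pverts G, parcs = ?D\<rparr>" by (rule all_arcs_orientation[OF hs cs])
  have ce: "card (edges G) = L + card A + card B"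
    using card_edges_orientation[OF graph ori] bij_betw_same_card[OF \<tau>(1)] by simp
  have AL: "card A + card B \<le> L + 2" using size ce card_verts by simp
  have star_label: "M \<le> \<tau> (a, \<sigma> a) \<and> \<tau> (a, \<sigma> a) < M + card A" if "a \<in> A" for a
  proof -
    have "\<tau> (a, \<sigma> a) \<in> S" using \<tau>(3) that by (auto simp: bij_betw_def)
    then show ?thesis by (auto simp: S_def M_def)
  qed
  \<comment> \<open>a twig label and a small label are below two star labels, and the third one covers the passages and the loss of 4\<close>
  have Bb: "net ?D \<tau> b < 3 * int M - 4" if b: "b \<in> B" for b
  proof -
    have bA: "b \<notin> A" using b disj by auto
    have pb: "\<pi> b \<in> A" using twig b by auto
    have "{w. (b, w) \<in> inner_arcs} \<subseteq> (A \<union> B) - {b, \<pi> b}"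
      using b pair_no_loops[of "(b, b)"] by (auto simp: inner_arcs_def)
    then have "card {w. (b, w) \<in> inner_arcs} \<le> card ((A \<union> B) - {b, \<pi> b})"
      using finite_parts by (intro card_mono) auto
    also have "\<dots> = card A + card B - 2"
    proof -
      have "b \<noteq> \<pi> b" using bA pb by auto
      then show ?thesis using b pb finite_parts disj by (simp add: card_Diff_subset card_Un_disjoint)
    qed
    finally have deg: "card {w. (b, w) \<in> inner_arcs} \<le> card A + card B - 2" .
    have "list_sum (length pre) hs b \<le> int (length pre + length hs) + int (card {w. (b, w) \<in> inner_arcs})"
      using hs bA by (auto simp: inner_list_def)
    moreover have "length pre + length hs \<le> L" by (simp add: L_def)
    moreover have "f b \<le> L + card B" using f(1) b by (auto simp: bij_betw_def P_def)
    moreover have "1 \<le> card B" using b finite_parts by (simp add: Suc_le_eq card_gt_0_iff) auto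
    ultimately show ?thesis using deg AL A3 by (simp add: \<tau>(6)[OF b] M_def)
  qed
  have nthl: "\<tau> ((pre @ hs @ post) ! i) = Suc i" if "i < L" for i
  proof -
    have "map \<tau> (pre @ hs @ post) ! i = [1..<Suc L] ! i" using \<tau>(2) by simp
    then show ?thesis using that L_def by (simp del: map_append upt_Suc)
  qed
  have notX: "fst e \<notin> X" if "e \<in> set hs \<union> twig_arcs \<union> star_arcs" for e
  proof -
    have "set hs \<subseteq> inner_arcs" using hs by (simp add: inner_list_def)
    then have "fst e \<in> A \<union> B" using that twig by (auto simp: inner_arcs_def twig_arcs_def star_arcs_def)
    then show ?thesis using disj by blast
  qed
  have outX: "{e \<in> ?D. fst e = x} \<subseteq> {(x, nx x)} \<inter> R" if x: "x \<in> X" for x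
  proof
    fix e assume e: "e \<in> {e \<in> ?D. fst e = x}"
    then have "e \<in> set (pre @ post)" using notX[of e] x by (auto simp: all_arcs_def)
    then have "e \<in> R \<union> Q \<union> set (s1 @ s2)" unfolding cset .
    moreover have "fst e \<notin> A" using e x disj by blast
    then have "e \<notin> Q" "e \<notin> set (s1 @ s2)" using s(2)[of e] by (auto simp: Q_def)
    ultimately have "e \<in> R" by blast
    then show "e \<in> {(x, nx x)} \<inter> R" using e by (auto simp: R_def)
  qed
  have rlab: "\<tau> e \<le> length s1 + card X" if "e \<in> R" for e
  proof -
    have "e \<in> set rs" using that rs(1) by simp
    then obtain i where i: "i < length rs" "e = rs ! i" by (auto simp: in_set_conv_nth)
    have "pre @ hs @ post = s1 @ (rs @ hs @ post)" by (simp add: pre_def)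
    then have "(pre @ hs @ post) ! (length s1 + i) = (rs @ hs @ post) ! i" by (simp only: nth_append_length_plus)
    then have "(pre @ hs @ post) ! (length s1 + i) = e" "length s1 + i < L"
      using i by (simp_all add: nth_append L_def pre_def)
    then have "\<tau> e = Suc (length s1 + i)" using nthl[of "length s1 + i"] by simp
    then show ?thesis using i lrs by simp
  qed
  have inD: "(a, x) \<in> ?D" if "a \<in> A" "x \<in> X" "(a, x) \<in> parcs G" for a x
    using cAX[OF that] that star_iff[of a x] by (auto simp: all_arcs_def)
  have Xpart: "{e \<in> ?D. fst e = x} \<subseteq> {(x, nx x)} \<and> ((x, nx x) \<in> ?D \<longrightarrow> \<tau> (x, nx x) \<le> 4) \<and>
        Y x \<subseteq> A \<and> card (Y x) = 3 \<and> (\<forall>y\<in>Y x. (y, x) \<in> ?D \<and> M \<le> \<tau> (y, x))" if x: "x \<in> X" for x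
  proof (intro conjI impI ballI)
    show "{e \<in> ?D. fst e = x} \<subseteq> {(x, nx x)}" using outX[OF x] by auto
    show "\<tau> (x, nx x) \<le> 4" if "(x, nx x) \<in> ?D"
    proof -
      have "(x, nx x) \<in> R" using outX[OF x] that by auto
      then show ?thesis using rlab[of "(x, nx x)"] cX by linarith
    qed
    show "Y x \<subseteq> A" "card (Y x) = 3" using Y[OF x] by auto
    fix y assume "y \<in> Y x"
    then have "y \<in> A" "\<sigma> y = x" using Y[OF x] by auto
    then show "(y, x) \<in> ?D" "M \<le> \<tau> (y, x)" using star_label[of y] star[of y] inD[of y x] by auto
  qed
  have Ab: "net ?D \<tau> a < 3 * int M - 4" if "a \<in> A" for a
    using \<tau>(5)[OF that] AL A3 by (simp add: M_def)
  have "centred ?D (L + card A + card B) M Y nx \<tau>"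
    unfolding centred_def using ori \<tau>(1,4) Ab Bb Xpart by blast
  moreover have "\<tau> e = 1" if "s1 = [e]" for e
    using nthl[of 0] that by (simp add: pre_def L_def)
  moreover have "\<tau> e = L" if "s2 = [e]" for e
  proof -
    have "(pre @ hs @ post) ! (L - 1) = e" "0 < L" using that by (auto simp: post_def L_def nth_append)
    then show ?thesis using nthl[of "L - 1"] by simp
  qed
  moreover have "\<tau> (x, nx x) \<le> length s1 + card X" if "x \<in> X" "(x, nx x) \<in> ?D" for x
  proof -
    have "(x, nx x) \<in> R" using outX[OF that(1)] that(2) by auto
    then show ?thesis by (rule rlab)
  qed
  moreover have "(x, nx x) \<in> ?D" if "x \<in> X" "nx x \<in> X" "(x, nx x) \<in> parcs G" for x
    using cXX[OF that] by (auto simp: all_arcs_def)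
  ultimately show ?thesis using that[of ?D _ M \<tau> L] star_label inD ce M_def by blast
qed

end

section \<open>The three cases\<close>

lemma dist_two_arcs:
  assumes G: "pair_graph G" and con: "Digraph_Component.connected (with_proj G)"
    and X: "X \<subseteq> pverts G" "X \<noteq> {}" and v: "v \<in> pverts G" "v \<notin> X"
    and d: "graph_dist_set G v X \<le> 2"
  shows "\<exists>x\<in>X. (v, x) \<in> parcs G \<or> (\<exists>a. (v, a) \<in> parcs G \<and> (a, x) \<in> parcs G)"
proof -
  interpret pair_graph G by fact
  have "finite X" using X(1) pair_finite_verts by (rule finite_subset)
  then have "Min (graph_dist G v ` X) \<in> graph_dist G v ` X" using X(2) by (intro Min_in) auto
  then obtain x where x: "x \<in> X" "graph_dist G v x \<le> 2" using d by (auto simp: graph_dist_set_def)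
  have "strongly_connected (with_proj G)"
    using symmetric_connected_imp_strongly_connected[OF sym_arcs con] .
  then have "v \<rightarrow>\<^sup>*\<^bsub>with_proj G\<^esub> x" using v(1) x(1) X(1) by (auto simp: strongly_connected_def)
  then obtain p0 where "apath v p0 x" using reachable_apath by blast
  then have "\<exists>n p. apath v p x \<and> length p = n" by blast
  then have "\<exists>p. apath v p x \<and> length p = graph_dist G v x"
    unfolding graph_dist_def by (rule LeastI_ex)
  then obtain p where p: "awalk v p x" "length p \<le> 2" using x(2) by (auto simp: apath_def)
  have "v \<noteq> x" using v x by auto
  show ?thesis
  proof (cases p)
    case Nil
    then show ?thesis using p(1) \<open>v \<noteq> x\<close> by (simp add: awalk_Nil_iff)
  next
    case (Cons e q)
    then have e: "e \<in> parcs G" "fst e = v" "awalk (snd e) q x" using p(1) by (auto simp: awalk_Cons_iff)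
    show ?thesis
    proof (cases q)
      case Nil
      then have "snd e = x" using e(3) by (simp add: awalk_Nil_iff)
      then show ?thesis using e x(1) by (metis prod.collapse)
    next
      case (Cons f r)
      then have "r = []" using p(2) \<open>p = e # q\<close> by simp
      then have "f \<in> parcs G" "fst f = snd e" "snd f = x"
        using e(3) Cons by (auto simp: awalk_Cons_iff awalk_Nil_iff)
      then show ?thesis using e x(1) by (metis prod.collapse)
    qed
  qed
qed

lemma layered_graph_exists:
  assumes G: "pair_graph G" and con: "Digraph_Component.connected (with_proj G)"
    and X: "X \<subseteq> pverts G" "X \<noteq> {}"
    and d: "\<forall>v\<in>pverts G - X. graph_dist_set G v X \<le> 2"
    and S: "\<And>y. y \<in> S \<Longrightarrow> y \<in> pverts G - X \<and> s y \<in> X \<and> (s y, y) \<in> parcs G"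
  obtains A B \<sigma> \<pi> where "layered_graph G A B X \<sigma> \<pi>" "\<And>y. y \<in> S \<Longrightarrow> \<sigma> y = s y"
    "\<And>a x. a \<in> pverts G - X \<Longrightarrow> x \<in> X \<Longrightarrow> (x, a) \<in> parcs G \<Longrightarrow> a \<in> A"
proof -
  interpret pair_graph G by fact
  note sym = reverse_arc[OF G]
  define A where "A = {a \<in> pverts G - X. \<exists>x\<in>X. (a, x) \<in> parcs G}"
  define B where "B = pverts G - X - A"
  define \<sigma> where "\<sigma> = (\<lambda>a. if a \<in> S then s a else SOME x. x \<in> X \<and> (a, x) \<in> parcs G)"
  define \<pi> where "\<pi> = (\<lambda>b. SOME a. a \<in> A \<and> (a, b) \<in> parcs G)"
  have st: "\<sigma> a \<in> X \<and> (a, \<sigma> a) \<in> parcs G" if "a \<in> A" for a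
  proof (cases "a \<in> S")
    case True
    then show ?thesis using S[OF True] sym by (simp add: \<sigma>_def)
  next
    case False
    have "\<exists>x. x \<in> X \<and> (a, x) \<in> parcs G" using that by (auto simp: A_def)
    from someI_ex[OF this] show ?thesis using False by (simp add: \<sigma>_def)
  qed
  have tw: "\<pi> b \<in> A \<and> (\<pi> b, b) \<in> parcs G" if "b \<in> B" for b
  proof -
    have b: "b \<in> pverts G" "b \<notin> X" "b \<notin> A" using that by (auto simp: B_def)
    obtain x where x: "x \<in> X" "(b, x) \<in> parcs G \<or> (\<exists>a. (b, a) \<in> parcs G \<and> (a, x) \<in> parcs G)"
      using dist_two_arcs[OF G con X b(1,2)] d b by auto
    have nb: "(b, y) \<notin> parcs G" if "y \<in> X" for y using that b by (auto simp: A_def)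
    obtain a where a: "(b, a) \<in> parcs G" "(a, x) \<in> parcs G" using x nb by blast
    have "a \<in> pverts G" "a \<notin> X" using wellformed[OF a(1)] a(1) nb by auto
    then have "a \<in> A \<and> (a, b) \<in> parcs G" using a x(1) sym[OF a(1)] by (auto simp: A_def)
    from someI[of "\<lambda>a. a \<in> A \<and> (a, b) \<in> parcs G", OF this] show ?thesis by (simp add: \<pi>_def)
  qed
  have "layered_graph G A B X \<sigma> \<pi>"
  proof (rule layered_graph.intro[OF G])
    show "pverts G = A \<union> B \<union> X" "A \<inter> B = {}" "A \<inter> X = {}" "B \<inter> X = {}"
      using X(1) by (auto simp: A_def B_def)
    show "(b, x) \<notin> parcs G" if "b \<in> B" "x \<in> X" for b x using that by (auto simp: A_def B_def)
  qed (use st tw in blast)+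
  moreover have "\<sigma> y = s y" if "y \<in> S" for y using that by (simp add: \<sigma>_def)
  moreover have "a \<in> A" if "a \<in> pverts G - X" "x \<in> X" "(x, a) \<in> parcs G" for a x
    using that sym[OF that(3)] by (auto simp: A_def)
  ultimately show ?thesis using that by blast
qed

text \<open>
  The hypothesis \<open>link\<close> provides the freedom to change the difference of the two sums at the centres:
  an edge between them that can be reversed, or a common neighbour whose labels can be permuted.
\<close>
theorem two_centres:
  assumes G: "pair_graph G" and con: "Digraph_Component.connected (with_proj G)"
    and X: "{x1, x2} \<subseteq> pverts G" "x1 \<noteq> x2"
    and d: "\<forall>v\<in>pverts G - {x1, x2}. graph_dist_set G v {x1, x2} \<le> 2"
    and size: "2 * card (pverts G) \<le> card (edges G) + 6"
    and Y: "card Y1 = 3" "card Y2 = 3" "Y1 \<inter> Y2 = {}" "Y1 \<union> Y2 \<subseteq> pverts G - {x1, x2}"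
    and a1: "\<And>y. y \<in> Y1 \<Longrightarrow> (x1, y) \<in> parcs G" and a2: "\<And>y. y \<in> Y2 \<Longrightarrow> (x2, y) \<in> parcs G"
    and link: "(x1, x2) \<in> parcs G \<or>
      (\<exists>z\<in>pverts G - {x1, x2} - Y1 - Y2. (x1, z) \<in> parcs G \<and> (x2, z) \<in> parcs G)"
  shows "\<exists>D \<tau>. antimagic_orientation G (D, \<tau>)"
proof -
  let ?X = "{x1, x2}"
  define s where "s = (\<lambda>y. if y \<in> Y1 then x1 else x2)"
  have S: "y \<in> pverts G - ?X \<and> s y \<in> ?X \<and> (s y, y) \<in> parcs G" if "y \<in> Y1 \<union> Y2" for y
    using that Y(4) a1 a2 by (auto simp: s_def)
  obtain A B \<sigma> \<pi> where lg: "layered_graph G A B ?X \<sigma> \<pi>" and \<sigma>: "\<And>y. y \<in> Y1 \<union> Y2 \<Longrightarrow> \<sigma> y = s y"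
    and inA: "\<And>a x. a \<in> pverts G - ?X \<Longrightarrow> x \<in> ?X \<Longrightarrow> (x, a) \<in> parcs G \<Longrightarrow> a \<in> A"
    using layered_graph_exists[OF G con X(1) _ d, of "Y1 \<union> Y2" s] S by (metis insert_not_empty)
  interpret layered_graph G A B ?X \<sigma> \<pi> by (rule lg)
  define Y where "Y = (\<lambda>x. if x = x1 then Y1 else Y2)"
  \<comment> \<open>a possible edge between the centres is directed to \<open>x2\<close>; there is no arc \<open>(x2, nx x2)\<close>\<close>
  define nx where "nx = (\<lambda>x. if x = x1 then x2 else x)"
  have YA: "Y1 \<subseteq> A" "Y2 \<subseteq> A" using S inA[of _ x1] inA[of _ x2] a1 a2 by blast+
  have noloop: "(v, v) \<notin> parcs G" for v using pair_no_loops[of "(v, v)"] by auto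
  have "card Y1 \<le> card A" using YA(1) finite_parts(1) by (intro card_mono)
  then have A3: "3 \<le> card A" using \<open>card Y1 = 3\<close> by simp
  have cX: "card ?X = 2" using X(2) by simp
  have size': "2 * card (pverts G) \<le> card (edges G) + 2 * card ?X + 2"
    and cX': "length ([] :: ('a \<times> 'a) list) + card ?X \<le> 4"
    using size by (simp_all add: cX)
  have nxp: "y = nx x \<longleftrightarrow> x \<noteq> nx y" if "x \<in> ?X" "y \<in> ?X" "(x, y) \<in> parcs G" for x y
    using that X(2) noloop by (auto simp: nx_def)
  have Yp: "card (Y x) = 3 \<and> (\<forall>y\<in>Y x. y \<in> A \<and> \<sigma> y = x)" if "x \<in> ?X" for x
    using that assms(7-9) X(2) YA \<sigma> by (auto simp: Y_def s_def)
  obtain D m M \<tau> L where c: "centred D m M Y nx \<tau>"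
    and lab: "\<And>x. x \<in> ?X \<Longrightarrow> (x, nx x) \<in> D \<Longrightarrow> \<tau> (x, nx x) \<le> length ([] :: ('a \<times> 'a) list) + card ?X"
    and inD: "\<And>a x. a \<in> A \<Longrightarrow> x \<in> ?X \<Longrightarrow> (a, x) \<in> parcs G \<Longrightarrow> (a, x) \<in> D"
    and nxD: "\<And>x. x \<in> ?X \<Longrightarrow> nx x \<in> ?X \<Longrightarrow> (x, nx x) \<in> parcs G \<Longrightarrow> (x, nx x) \<in> D"
    by (rule many_centres[of nx "[]" "[]" Y, OF size' A3 nxp cX' _ _ Yp])
       (assumption | simp | (rule that, assumption, assumption, assumption, assumption))+
  from link show ?thesis
  proof
    assume e: "(x1, x2) \<in> parcs G"
    have nx1: "nx x1 = x2" "nx x2 = x2" using X(2) by (auto simp: nx_def)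
    then have "(x1, x2) \<in> D" using nxD[of x1] e by simp
    moreover have "\<tau> (x1, x2) \<le> 2" using lab[of x1] nx1 calculation cX by simp
    moreover have "{e \<in> D. fst e = x2} = {}"
    proof -
      have sub: "{e \<in> D. fst e = x2} \<subseteq> {(x2, x2)}" "D \<subseteq> parcs G"
        using c nx1 by (auto simp: centred_def is_orientation_def)
      show ?thesis
      proof (rule equals0I)
        fix e assume "e \<in> {e \<in> D. fst e = x2}"
        then have "e = (x2, x2)" "e \<in> parcs G" using sub by (blast, blast)
        then show False using noloop[of x2] by simp
      qed
    qed
    ultimately show ?thesis by (rule centred_edge[OF c refl X(2)])
  next
    assume "\<exists>z\<in>pverts G - ?X - Y1 - Y2. (x1, z) \<in> parcs G \<and> (x2, z) \<in> parcs G"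
    then obtain z where z: "z \<in> pverts G - ?X" "z \<notin> Y1" "z \<notin> Y2" "(x1, z) \<in> parcs G" "(x2, z) \<in> parcs G"
      by blast
    have zA: "z \<in> A" using inA[of z x1] z by simp
    show ?thesis
      by (rule centred_common_neighbour[OF c zA]) (use z inD[OF zA] arc_sym in \<open>auto simp: Y_def\<close>)
  qed
qed

text \<open>
  If \<open>z = z'\<close>, this vertex is adjacent to all three centres. Otherwise the arcs \<open>(z, x2)\<close> and
  \<open>(z', x2)\<close> are given the smallest and the largest label below the twigs and star arcs.
  These differ by more than any two star labels, which makes the amounts moved by the two swaps in \<open>centred_chain\<close>
  different.
\<close>
theorem three_centres:
  assumes G: "pair_graph G" and con: "Digraph_Component.connected (with_proj G)"
    and X: "{x1, x2, x3} \<subseteq> pverts G" "distinct [x1, x2, x3]"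
    and d: "\<forall>v\<in>pverts G - {x1, x2, x3}. graph_dist_set G v {x1, x2, x3} \<le> 2"
    and size: "2 * card (pverts G) \<le> card (edges G) + 4"
    and Y: "card Y1 = 3" "card Y2 = 3" "card Y3 = 3" "Y1 \<inter> Y2 = {}" "Y1 \<inter> Y3 = {}" "Y2 \<inter> Y3 = {}"
      "Y1 \<union> Y2 \<union> Y3 \<subseteq> pverts G - {x1, x2, x3}"
    and a1: "\<And>y. y \<in> Y1 \<Longrightarrow> (x1, y) \<in> parcs G" and a2: "\<And>y. y \<in> Y2 \<Longrightarrow> (x2, y) \<in> parcs G"
    and a3: "\<And>y. y \<in> Y3 \<Longrightarrow> (x3, y) \<in> parcs G"
    and z: "z \<in> pverts G - {x1, x2, x3} - Y1 - Y2 - Y3" "(x1, z) \<in> parcs G" "(x2, z) \<in> parcs G"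
    and z': "z' \<in> pverts G - {x1, x2, x3} - Y1 - Y2 - Y3" "(x2, z') \<in> parcs G" "(x3, z') \<in> parcs G"
  shows "\<exists>D \<tau>. antimagic_orientation G (D, \<tau>)"
proof -
  let ?X = "{x1, x2, x3}"
  have xs: "x1 \<noteq> x2" "x2 \<noteq> x3" "x1 \<noteq> x3" using X(2) by auto
  \<comment> \<open>unless they coincide, \<open>z\<close> and \<open>z'\<close> have their star arcs to the outer centres, so that their arcs
     to \<open>x2\<close> may get small labels\<close>
  define s where "s = (\<lambda>y. if y \<in> insert z Y1 then x1 else if y \<in> Y2 then x2 else x3)"
  let ?S = "insert z (insert z' (Y1 \<union> Y2 \<union> Y3))"
  have S: "y \<in> pverts G - ?X \<and> s y \<in> ?X \<and> (s y, y) \<in> parcs G" if "y \<in> ?S" for y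
    using that Y(7) a1 a2 a3 z z' by (auto simp: s_def)
  obtain A B \<sigma> \<pi> where lg: "layered_graph G A B ?X \<sigma> \<pi>" and \<sigma>: "\<And>y. y \<in> ?S \<Longrightarrow> \<sigma> y = s y"
    and inA: "\<And>a x. a \<in> pverts G - ?X \<Longrightarrow> x \<in> ?X \<Longrightarrow> (x, a) \<in> parcs G \<Longrightarrow> a \<in> A"
    using layered_graph_exists[OF G con X(1) _ d, of ?S s] S by (metis insert_not_empty)
  interpret layered_graph G A B ?X \<sigma> \<pi> by (rule lg)
  define Y where "Y = (\<lambda>x. if x = x1 then Y1 else if x = x2 then Y2 else Y3)"
  \<comment> \<open>edges between the centres follow a cyclic orientation\<close>
  define nx where "nx = (\<lambda>x. if x = x1 then x2 else if x = x2 then x3 else x1)"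
  have SA: "?S \<subseteq> A" using S inA by blast
  have noloop: "(v, v) \<notin> parcs G" for v using pair_no_loops[of "(v, v)"] by auto
  have "card Y1 \<le> card A" using SA finite_parts(1) by (intro card_mono) auto
  then have A3: "3 \<le> card A" using \<open>card Y1 = 3\<close> by simp
  have cX: "card ?X = 3" using xs by simp
  have size': "2 * card (pverts G) \<le> card (edges G) + 2 * card ?X + 2"
    using size by (simp add: cX)
  have nxp: "y = nx x \<longleftrightarrow> x \<noteq> nx y" if "x \<in> ?X" "y \<in> ?X" "(x, y) \<in> parcs G" for x y
    using that xs noloop by (auto simp: nx_def)
  have Yp: "card (Y x) = 3 \<and> (\<forall>y\<in>Y x. y \<in> A \<and> \<sigma> y = x)" if "x \<in> ?X" for x
    using that assms(7-12) xs SA \<sigma> z(1) by (auto simp: Y_def s_def)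
  have zn: "z \<notin> Y x" "z' \<notin> Y x" if "x \<in> ?X" for x using that z(1) z'(1) by (auto simp: Y_def)
  show ?thesis
  proof (cases "z = z'")
    case True
    have cX': "length ([] :: ('a \<times> 'a) list) + card ?X \<le> 4" by (simp add: cX)
    obtain D m M \<tau> L where c: "centred D m M Y nx \<tau>"
      and inD: "\<And>a x. a \<in> A \<Longrightarrow> x \<in> ?X \<Longrightarrow> (a, x) \<in> parcs G \<Longrightarrow> (a, x) \<in> D"
      by (rule many_centres[of nx "[]" "[]" Y, OF size' A3 nxp cX' _ _ Yp])
         (assumption | simp | (rule that, assumption, assumption))+
    have zA: "z \<in> A" using SA by simp
    show ?thesis
      by (rule centred_common_neighbour[OF c zA]) (use z z' zn True inD[OF zA] arc_sym in auto)
  next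
    case False
    have zA: "z \<in> A" "z' \<in> A" using SA by simp_all
    have sz: "\<sigma> z = x1" "\<sigma> z' = x3" using \<sigma>[of z] \<sigma>[of z'] z'(1) False by (auto simp: s_def)
    have arcs: "(z, x1) \<in> parcs G" "(z, x2) \<in> parcs G" "(z', x2) \<in> parcs G" "(z', x3) \<in> parcs G"
      using z z' arc_sym by auto
    obtain D m M \<tau> L where c: "centred D m M Y nx \<tau>" and M: "M = L + card B + 1"
      and ce: "card (edges G) = L + card A + card B"
      and st: "\<And>a. a \<in> A \<Longrightarrow> M \<le> \<tau> (a, \<sigma> a) \<and> \<tau> (a, \<sigma> a) < M + card A"
      and l1: "\<And>e. [(z, x2)] = [e] \<Longrightarrow> \<tau> e = 1" and l2: "\<And>e. [(z', x2)] = [e] \<Longrightarrow> \<tau> e = L"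
      and inD: "\<And>a x. a \<in> A \<Longrightarrow> x \<in> ?X \<Longrightarrow> (a, x) \<in> parcs G \<Longrightarrow> (a, x) \<in> D"
    proof -
      have 1: "length [(z, x2)] + card ?X \<le> 4" by (simp add: cX)
      have 2: "distinct ([(z, x2)] @ [(z', x2)])" using False by simp
      have 3: "fst e \<in> A \<and> snd e \<in> ?X \<and> e \<in> parcs G \<and> snd e \<noteq> \<sigma> (fst e)"
        if "e \<in> set ([(z, x2)] @ [(z', x2)])" for e
      proof -
        have "e = (z, x2) \<or> e = (z', x2)" using that by simp
        then show ?thesis using zA arcs sz xs by (elim disjE) simp_all
      qed
      show ?thesis
        by (rule many_centres[of nx "[(z, x2)]" "[(z', x2)]" Y, OF size' A3 nxp 1 2 3 Yp])
           (assumption, assumption, assumption, assumption, assumption, rule that,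
            assumption, assumption, assumption, assumption, assumption, assumption, assumption)
    qed
    have l: "\<tau> (z, x2) = 1" "\<tau> (z', x2) = L" by (rule l1, rule refl, rule l2, rule refl)
    have "card (pverts G) = card A + card B + 3" using card_verts cX by simp
    \<comment> \<open>so \<open>L - 1\<close>, the difference of the labels of \<open>(z', x2)\<close> and \<open>(z, x2)\<close>, exceeds that of any two star labels\<close>
    then have "card A < L" using size ce by simp
    then have gap: "\<tau> (z', x2) < \<tau> (z', x3)"
      "int (\<tau> (z', x3)) - int (\<tau> (z', x2)) < int (\<tau> (z, x1)) - int (\<tau> (z, x2))"
      using st[OF zA(1)] st[OF zA(2)] by (simp_all add: sz l M)
    show ?thesis
      by (rule centred_chain[OF c refl X(2) zA False _ _ _ _ _ gap])
         (use inD zA arcs zn in auto)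
  qed
qed

theorem theorem1p7:
  fixes G :: "'a pair_pre_digraph" and t :: nat and x :: "nat \<Rightarrow> 'a" and X :: "'a set"
  assumes "pair_graph G"
    and "Digraph_Component.connected (with_proj G)"
    and "t \<in> {1, 2, 3}"
    and "inj_on x {1..t}"
    and "X = x ` {1..t}"
    and "X \<subseteq> pverts G"
    and "\<forall>v \<in> pverts G - X. graph_dist_set G v X \<le> 2"
    and "(t = 1 \<and> card (neighbors G (x 1)) \<ge> 2)
       \<or> (t = 2 \<and> int (card (edges G)) \<ge> 2 * int (card (pverts G)) - 5 \<and>
          (\<exists>y :: nat \<Rightarrow> 'a. inj_on y {1..7} \<and> y ` {1..7} \<subseteq> pverts G - X \<and>
             (complete_to G (x 1) {y 1, y 2, y 3, x 2} \<or> complete_to G (x 1) {y 1, y 2, y 3, y 4}) \<and>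
             complete_to G (x 2) {y 4, y 5, y 6, y 7}))
       \<or> (t = 3 \<and> int (card (edges G)) \<ge> 2 * int (card (pverts G)) - 4 \<and>
          (\<exists>y :: nat \<Rightarrow> 'a. inj_on y {1..11} \<and> y ` {1..11} \<subseteq> pverts G - X \<and>
             complete_to G (x 1) {y 1, y 2, y 3, y 4} \<and>
             complete_to G (x 2) {y 4, y 5, y 6, y 7, y 8} \<and>
             (complete_to G (x 3) {y 4, y 9, y 10, y 11} \<or> complete_to G (x 3) {y 8, y 9, y 10, y 11})))"
  shows "\<exists>(D :: 'a pair_pre_digraph) (\<tau> :: 'a \<times> 'a \<Rightarrow> nat). antimagic_orientation G (D, \<tau>)"
proof -
  consider (one) "t = 1" "2 \<le> card (neighbors G (x 1))"
    | (two) y :: "nat \<Rightarrow> 'a" where "t = 2" "2 * int (card (pverts G)) - 5 \<le> int (card (edges G))"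
      "inj_on y {1..7}" "y ` {1..7} \<subseteq> pverts G - X"
      "complete_to G (x 1) {y 1, y 2, y 3, x 2} \<or> complete_to G (x 1) {y 1, y 2, y 3, y 4}"
      "complete_to G (x 2) {y 4, y 5, y 6, y 7}"
    | (three) y :: "nat \<Rightarrow> 'a" where "t = 3" "2 * int (card (pverts G)) - 4 \<le> int (card (edges G))"
      "inj_on y {1..11}" "y ` {1..11} \<subseteq> pverts G - X"
      "complete_to G (x 1) {y 1, y 2, y 3, y 4}" "complete_to G (x 2) {y 4, y 5, y 6, y 7, y 8}"
      "complete_to G (x 3) {y 4, y 9, y 10, y 11} \<or> complete_to G (x 3) {y 8, y 9, y 10, y 11}"
    using assms(8) by (elim disjE[of "t = 1 \<and> _"] disjE[of "t = 2 \<and> _"] conjE exE) metis+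
  then show ?thesis
  proof cases
    case one
    note t = one(1) and deg = one(2)
    interpret pair_graph G by fact
    have X: "X = {x 1}" using assms(5) t by simp
    obtain A B \<sigma> \<pi> where lg: "layered_graph G A B X \<sigma> \<pi>"
      and inA: "\<And>a x. a \<in> pverts G - X \<Longrightarrow> x \<in> X \<Longrightarrow> (x, a) \<in> parcs G \<Longrightarrow> a \<in> A"
    proof -
      have "X \<noteq> {}" using X by simp
      then show ?thesis
        by (rule layered_graph_exists[OF assms(1,2,6) _ assms(7), of "{}" id])
           (assumption | (rule that, assumption, assumption) | simp)+
    qed
    have "neighbors G (x 1) \<noteq> {}" using deg by auto
    then obtain a where a: "(x 1, a) \<in> parcs G" by (auto simp: neighbors_def)
    then have "a \<in> pverts G" "a \<noteq> x 1" using wellformed[OF a] pair_no_loops[OF a] by auto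
    then have "A \<noteq> {}" using inA[of a "x 1"] a X by auto
    then show ?thesis by (rule layered_graph.single_centre[OF lg X])
  next
    case two
    note t = two(1) and size = two(2) and inj = two(3) and y = two(4) and c1 = two(5) and c2 = two(6)
    have "{1..2} = {1::nat, 2}" by auto
    then have X: "X = {x 1, x 2}" "x 1 \<noteq> x 2" using assms(4,5) t by auto
    have yv: "y i \<in> pverts G - {x 1, x 2}" if "i \<in> {1..7}" for i using that y unfolding X(1) by blast
    have yd: "y i = y j \<longleftrightarrow> i = j" if "i \<in> {1..7}" "j \<in> {1..7}" for i j
      using that inj by (auto simp: inj_on_def)
    have link: "(x 1, x 2) \<in> parcs G \<or> (\<exists>z\<in>pverts G - {x 1, x 2} - {y 1, y 2, y 3} - {y 5, y 6, y 7}.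
        (x 1, z) \<in> parcs G \<and> (x 2, z) \<in> parcs G)"
      using c1
    proof
      assume "complete_to G (x 1) {y 1, y 2, y 3, y 4}"
      then have "(x 1, y 4) \<in> parcs G" "(x 2, y 4) \<in> parcs G" using c2 by (auto simp: complete_to_def)
      then show ?thesis using yv[of 4] yd by (intro disjI2 bexI[of _ "y 4"]) auto
    qed (auto simp: complete_to_def)
    show ?thesis
      by (rule two_centres[OF assms(1,2) _ X(2) _ _ _ _ _ _ _ _ link])
         (use assms(6,7) X size c1 c2 yv yd in \<open>auto simp: complete_to_def\<close>)
  next
    case three
    note t = three(1) and size = three(2) and inj = three(3) and y = three(4)
      and c1 = three(5) and c2 = three(6) and c3 = three(7)
    have "{1..3} = {1::nat, 2, 3}" by auto
    then have X: "X = {x 1, x 2, x 3}" "distinct [x 1, x 2, x 3]" using assms(4,5) t by auto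
    have yv: "y i \<in> pverts G - {x 1, x 2, x 3}" if "i \<in> {1..11}" for i using that y unfolding X(1) by blast
    have yd: "y i = y j \<longleftrightarrow> i = j" if "i \<in> {1..11}" "j \<in> {1..11}" for i j
      using that inj by (auto simp: inj_on_def)
    obtain k where k: "k = 4 \<or> k = (8::nat)" "complete_to G (x 3) {y k, y 9, y 10, y 11}" using c3 by blast
    have XG: "{x 1, x 2, x 3} \<subseteq> pverts G" using assms(6) X(1) by simp
    have dist: "\<forall>v\<in>pverts G - {x 1, x 2, x 3}. graph_dist_set G v {x 1, x 2, x 3} \<le> 2"
      using assms(7) unfolding X(1) .
    have arcs: "\<And>v. v \<in> {y 1, y 2, y 3} \<Longrightarrow> (x 1, v) \<in> parcs G"
      "\<And>v. v \<in> {y 5, y 6, y 7} \<Longrightarrow> (x 2, v) \<in> parcs G"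
      "\<And>v. v \<in> {y 9, y 10, y 11} \<Longrightarrow> (x 3, v) \<in> parcs G"
      "(x 1, y 4) \<in> parcs G" "(x 2, y 4) \<in> parcs G" "(x 2, y k) \<in> parcs G" "(x 3, y k) \<in> parcs G"
    proof -
      have 1: "(x 1, v) \<in> parcs G" if "v \<in> {y 1, y 2, y 3, y 4}" for v
        using c1 that unfolding complete_to_def by blast
      have 2: "(x 2, v) \<in> parcs G" if "v \<in> {y 4, y 5, y 6, y 7, y 8}" for v
        using c2 that unfolding complete_to_def by blast
      have 3: "(x 3, v) \<in> parcs G" if "v \<in> {y k, y 9, y 10, y 11}" for v
        using k(2) that unfolding complete_to_def by blast
      show "\<And>v. v \<in> {y 1, y 2, y 3} \<Longrightarrow> (x 1, v) \<in> parcs G"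
        "\<And>v. v \<in> {y 5, y 6, y 7} \<Longrightarrow> (x 2, v) \<in> parcs G"
        "\<And>v. v \<in> {y 9, y 10, y 11} \<Longrightarrow> (x 3, v) \<in> parcs G"
        by (rule 1, blast) (rule 2, blast, rule 3, blast)
      show "(x 1, y 4) \<in> parcs G" "(x 2, y 4) \<in> parcs G" "(x 3, y k) \<in> parcs G"
        by (rule 1, simp) (rule 2, simp, rule 3, simp)
      have "y k \<in> {y 4, y 5, y 6, y 7, y 8}" using k(1) by (elim disjE) simp_all
      then show "(x 2, y k) \<in> parcs G" by (rule 2)
    qed
    let ?Y1 = "{y 1, y 2, y 3}" and ?Y2 = "{y 5, y 6, y 7}" and ?Y3 = "{y 9, y 10, y 11}"
    have sep: "card ?Y1 = 3" "card ?Y2 = 3" "card ?Y3 = 3"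
      "?Y1 \<inter> ?Y2 = {}" "?Y1 \<inter> ?Y3 = {}" "?Y2 \<inter> ?Y3 = {}"
      by (simp_all add: yd)
    have sub: "?Y1 \<union> ?Y2 \<union> ?Y3 \<subseteq> pverts G - {x 1, x 2, x 3}" using yv by simp
    have out: "y i \<in> pverts G - {x 1, x 2, x 3} - ?Y1 - ?Y2 - ?Y3" if "i = 4 \<or> i = 8" for i
      using that yv[of i] yd by (elim disjE) simp_all
    have "2 * card (pverts G) \<le> card (edges G) + 4" using size by linarith
    then show ?thesis
      by (rule three_centres[OF assms(1,2) XG X(2) dist _ sep sub arcs(1-3)
          out[of 4] arcs(4,5) out[OF k(1)] arcs(6,7)]) simp_all
  qed
qed

end
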